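(* Let $\alpha>0$. The map $q_\alpha(f)=\sum_{n\in\mathbb{Z}}k^{\alpha+1}(|n|)\,|W^\alpha f(n)|$ is a norm on $c_{0,0}(\mathbb{Z})$, and there is a constant $C_\alpha>0$ such that $$q_\alpha(f*g)\le C_\alpha\, q_\alpha(f)\,q_\alpha(g),\qquad f,g\in c_{0,0}(\mathbb{Z}).$$ Consequently the space $\tau^\alpha(|n|^\alpha)$ of complex sequences $f$ on $\mathbb{Z}$ with $f(n)\to0$ as $|n|\to\infty$ and $q_\alpha(f)<\infty$ is a Banach algebra under convolution. Moreover, for $\beta>\alpha>0$ one has $\|f\|_{\ell^1(\mathbb{Z})}\le q_\alpha(f)\le q_\beta(f)$ for all $f\in c_{0,0}(\mathbb{Z})$, giving continuous embeddings $\tau^\beta(|n|^\beta)\hookrightarrow\tau^\alpha(|n|^\alpha)\hookrightarrow\ell^1(\mathbb{Z})$, and $\lim_{\alpha\to0^+}q_\alpha(f)=\|f\|_{\ell^1(\mathbb{Z})}$ for $f\in c_{0,0}(\mathbb{Z})$.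
   Context: $c_{0,0}(\mathbb{Z})$ is the space of finitely supported complex sequences on $\mathbb{Z}$, with convolution $(f*g)(n)=\sum_{j\in\mathbb{Z}}f(n-j)g(j)$. For $\gamma\in\mathbb{R}$, $k^\gamma(0)=1$, $k^\gamma(n)=\frac{\gamma(\gamma+1)\cdots(\gamma+n-1)}{n!}$ for $n\ge1$. $W_+f(n)=f(n)-f(n+1)$, $W_-f(n)=f(n)-f(n-1)$, $W_\pm^m$ their powers. For $\alpha>0$: $W_+^{-\alpha}f(n)=\sum_{j\ge n}k^\alpha(j-n)f(j)$, $W_-^{-\alpha}f(n)=\sum_{j\le n}k^\alpha(n-j)f(j)$, $W_\pm^\alpha f=W_\pm^mW_\pm^{-(m-\alpha)}f$ with $m=[\alpha]+1$; $W^\alpha f(n)=W_+^\alpha f(n)$ for $n\ge0$ and $W^\alpha f(n)=W_-^\alpha f(n)$ for $n<0$ (for sequences not in $c_{0,0}$, these are defined whenever the series converge). *)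

theory Defs
  imports "HOL-Analysis.Analysis"
begin

type_synonym seq = "int \<Rightarrow> complex"

definition kk :: "real \<Rightarrow> nat \<Rightarrow> real" where
  "kk \<gamma> n = pochhammer \<gamma> n / fact n"

definition c00 :: "seq set" where
  "c00 = {f. finite {n. f n \<noteq> 0}}"

definition conv :: "seq \<Rightarrow> seq \<Rightarrow> seq" where
  "conv f g n = (\<Sum>\<^sub>\<infinity>j. f (n - j) * g j)"

definition l1norm :: "seq \<Rightarrow> real" where
  "l1norm f = (\<Sum>\<^sub>\<infinity>n. norm (f n))"

definition Wp :: "seq \<Rightarrow> seq" where "Wp f n = f n - f (n + 1)"
definition Wm :: "seq \<Rightarrow> seq" where "Wm f n = f n - f (n - 1)"

definition Wp_neg :: "real \<Rightarrow> seq \<Rightarrow> seq" where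
  "Wp_neg a f n = (\<Sum>m. of_real (kk a m) * f (n + int m))"
definition Wm_neg :: "real \<Rightarrow> seq \<Rightarrow> seq" where
  "Wm_neg a f n = (\<Sum>m. of_real (kk a m) * f (n - int m))"

definition Wp_frac :: "real \<Rightarrow> seq \<Rightarrow> seq" where
  "Wp_frac a f = (Wp ^^ (nat \<lfloor>a\<rfloor> + 1)) (Wp_neg (real (nat \<lfloor>a\<rfloor> + 1) - a) f)"
definition Wm_frac :: "real \<Rightarrow> seq \<Rightarrow> seq" where
  "Wm_frac a f = (Wm ^^ (nat \<lfloor>a\<rfloor> + 1)) (Wm_neg (real (nat \<lfloor>a\<rfloor> + 1) - a) f)"

definition W :: "real \<Rightarrow> seq \<Rightarrow> seq" where
  "W a f n = (if n \<ge> 0 then Wp_frac a f n else Wm_frac a f n)"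

definition qa :: "real \<Rightarrow> seq \<Rightarrow> real" where
  "qa a f = (\<Sum>\<^sub>\<infinity>n. kk (a + 1) (nat \<bar>n\<bar>) * norm (W a f n))"

text \<open>tau^a(|n|^a): f(n) \<rightarrow> 0 as |n| \<rightarrow> \<infinity>, the series defining W^a f converge,
  and q_a(f) < \<infinity>.\<close>
definition tau :: "real \<Rightarrow> seq set" where
  "tau a = {f. (f \<longlongrightarrow> 0) at_top \<and> (f \<longlongrightarrow> 0) at_bot
      \<and> (\<forall>n. summable (\<lambda>m. of_real (kk (real (nat \<lfloor>a\<rfloor> + 1) - a) m) * f (n + int m)))
      \<and> (\<forall>n. summable (\<lambda>m. of_real (kk (real (nat \<lfloor>a\<rfloor> + 1) - a) m) * f (n - int m)))
      \<and> (\<lambda>n. kk (a + 1) (nat \<bar>n\<bar>) * norm (W a f n)) summable_on UNIV}"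

definition l1 :: "seq set" where
  "l1 = {f. (\<lambda>n. norm (f n)) summable_on UNIV}"

definition is_norm_on :: "seq set \<Rightarrow> (seq \<Rightarrow> real) \<Rightarrow> bool" where
  "is_norm_on S p \<longleftrightarrow>
     (\<forall>f\<in>S. 0 \<le> p f) \<and> (\<forall>f\<in>S. p f = 0 \<longrightarrow> f = (\<lambda>n. 0))
     \<and> (\<forall>f\<in>S. \<forall>c::complex. p (\<lambda>n. c * f n) = norm c * p f)
     \<and> (\<forall>f\<in>S. \<forall>g\<in>S. p (\<lambda>n. f n + g n) \<le> p f + p g)"

definition is_subspace :: "seq set \<Rightarrow> bool" where
  "is_subspace S \<longleftrightarrow> (\<lambda>n. 0) \<in> S \<and> (\<forall>f\<in>S. \<forall>g\<in>S. (\<lambda>n. f n + g n) \<in> S)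
     \<and> (\<forall>f\<in>S. \<forall>c::complex. (\<lambda>n. c * f n) \<in> S)"

definition complete_wrt :: "seq set \<Rightarrow> (seq \<Rightarrow> real) \<Rightarrow> bool" where
  "complete_wrt S p \<longleftrightarrow> (\<forall>X. (\<forall>k. X k \<in> S) \<and>
      (\<forall>e>0. \<exists>N. \<forall>j\<ge>N. \<forall>k\<ge>N. p (\<lambda>n. X j n - X k n) < e)
      \<longrightarrow> (\<exists>L\<in>S. (\<lambda>k. p (\<lambda>n. X k n - L n)) \<longlonglongrightarrow> 0))"

end

theory Submission
  imports Defs
begin

text \<open>
  Every element of \<open>\<tau>\<^sup>\<alpha>\<close> is the synthesis \<open>f = \<Sum>\<^sub>n F(n) e\<^sub>n\<close> of its derivative
  \<open>F = W\<^sup>\<alpha> f\<close>, where the atom \<open>e\<^sub>n\<close> is \<open>k \<mapsto> k\<^sup>\<alpha>(n - k)\<close> on \<open>[0, n]\<close> if \<open>n \<ge> 0\<close>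
  and \<open>k \<mapsto> k\<^sup>\<alpha>(k - n)\<close> on \<open>[n, -1]\<close> if \<open>n < 0\<close>.
  Hence \<open>q\<^sub>\<alpha>\<close> identifies \<open>\<tau>\<^sup>\<alpha>\<close> with \<open>l\<^sup>1\<close> weighted by \<open>k\<^bsup>\<alpha>+1\<^esup>(|n|)\<close>; this yields the norm,
  completeness, and (by \<open>k\<^sup>\<alpha> * k\<^sup>\<gamma> = k\<^bsup>\<alpha>+\<gamma>\<^esup>\<close>) the embeddings.  The delicate point is that the
  series defining \<open>W\<^sup>\<alpha> f\<close> is only assumed to converge conditionally: synthesis is justified by
  Abel summation, which shows that a null sequence \<open>u\<close> with \<open>\<Delta>\<^sup>m W\<^bsup>-b\<^esup> u = 0\<close>, \<open>0 < b \<le> 1\<close>,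
  vanishes.  For the algebra property it suffices to bound \<open>q\<^sub>\<alpha>(e\<^sub>n * e\<^sub>m)\<close>.  With
  \<open>K = \<Sum>\<^sub>i k\<^sup>\<alpha>(i) z\<^sup>i = (1 - z)\<^bsup>-\<alpha>\<^esup>\<close> and \<open>T\<^sub>n\<close> its part of degree \<open>> n\<close>, one has
  \<open>K\<^sup>-\<^sup>1 (K - T\<^sub>n)(K - T\<^sub>m) = K - T\<^sub>n - T\<^sub>m + K\<^sup>-\<^sup>1 T\<^sub>n T\<^sub>m\<close>, and the last term has degree \<open>> n + m + 1\<close>;
  so, up to sign, the derivative of \<open>e\<^sub>n * e\<^sub>m\<close> is \<open>k\<^sup>\<alpha>(n + m - l)\<close> restricted to
  \<open>l < min n m\<close> and \<open>l \<ge> max n m\<close>, when \<open>n, m \<ge> 0\<close>.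
\<close>

section \<open>The kernels \<open>k\<^sup>\<gamma>\<close>\<close>

lemma kk_0 [simp]: "kk g 0 = 1"
  by (simp add: kk_def)

lemma kk_Suc: "kk g (Suc n) = kk g n * (g + real n) / real (Suc n)"
  by (simp add: kk_def pochhammer_Suc)

lemma kk_zero: "kk 0 n = (if n = 0 then 1 else 0)"
  by (cases n) (simp_all add: kk_def pochhammer_rec)

lemma kk_one [simp]: "kk 1 n = 1"
  by (simp add: kk_def flip: pochhammer_fact)

lemma kk_nonneg [simp]: "0 \<le> g \<Longrightarrow> 0 \<le> kk g n"
  by (induction n) (simp_all add: kk_Suc)

lemma kk_pos: "0 < g \<Longrightarrow> 0 < kk g n"
  by (induction n) (simp_all add: kk_Suc)

lemma kk_mono: "0 \<le> g \<Longrightarrow> g \<le> h \<Longrightarrow> kk g n \<le> kk h n"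
  by (induction n) (auto simp: kk_Suc intro!: divide_right_mono mult_mono)

lemma kk_le_1: "0 \<le> b \<Longrightarrow> b \<le> 1 \<Longrightarrow> kk b n \<le> 1"
  using kk_mono[of b 1 n] by simp

text \<open>Vandermonde's identity for rising factorials, that is,
  \<open>(1 - z)^(-a) (1 - z)^(-b)\<close> compared coefficientwise. No sign condition is imposed:
  the choice of opposite orders gives the inversion formula used on the half line.\<close>

lemma kk_add: "kk (a + b) n = (\<Sum>i\<le>n. kk a i * kk b (n - i))"
proof -
  have "kk (a + b) n = (\<Sum>i\<le>n. of_nat (n choose i) * pochhammer a i * pochhammer b (n - i) / fact n)"
    by (simp add: kk_def pochhammer_binomial_sum sum_divide_distrib)
  also have "\<dots> = (\<Sum>i\<le>n. kk a i * kk b (n - i))"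
    by (intro sum.cong) (simp_all add: kk_def binomial_fact)
  finally show ?thesis .
qed

lemma kk_sum: "kk (a + 1) n = (\<Sum>i\<le>n. kk a i)"
  using kk_add[of a 1 n] by simp

lemma kk_diff: "kk (a + 1) (Suc n) - kk (a + 1) n = kk a (Suc n)"
  by (simp add: kk_sum)

lemma kk_mono_index: "0 \<le> a \<Longrightarrow> i \<le> j \<Longrightarrow> kk (a + 1) i \<le> kk (a + 1) j"
  unfolding kk_sum by (intro sum_mono2) auto

lemma kk_ge_1: "0 \<le> a \<Longrightarrow> 1 \<le> kk (a + 1) n"
  using kk_mono_index[of a 0 n] by simp

text \<open>Both sides are \<open>a (a + 1) ... (a + n) / n!\<close>. This trades
  \<open>kk a\<close> for the monotone \<open>kk (a + 1)\<close> with a gain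
  \<open>a / (a + n)\<close>.\<close>

lemma kk_shift: "kk a n * (a + real n) = a * kk (a + 1) n"
proof (induction n)
  case (Suc n)
  have "kk a (Suc n) * (a + real (Suc n)) = kk a n * (a + real n) * (a + real (Suc n)) / real (Suc n)"
    by (simp add: kk_Suc)
  also have "\<dots> = a * kk (a + 1) (Suc n)"
    unfolding Suc by (simp add: kk_Suc algebra_simps)
  finally show ?case .
qed simp

text \<open>One step beyond \<open>n\<close> costs a factor at most
  \<open>1 + a / n \<le> exp (a / n)\<close>, and at most \<open>n\<close> steps are taken. This is
  where the factor \<open>exp a\<close> of the algebra constant originates.\<close>

lemma kk_doubling:
  assumes "0 \<le> a" "m \<le> n"
  shows "kk (a + 1) (n + m) \<le> exp a * kk (a + 1) n"
proof (cases "n = 0")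
  case False
  have "kk (a + 1) (n + j) \<le> exp (real j * (a / real n)) * kk (a + 1) n" for j
  proof (induction j)
    case (Suc j)
    have "kk (a + 1) (n + Suc j) = kk (a + 1) (n + j) * (1 + a / real (Suc (n + j)))"
      using assms by (simp add: kk_Suc field_simps)
    also have "\<dots> \<le> (exp (real j * (a / real n)) * kk (a + 1) n) * exp (a / real n)"
    proof (intro mult_mono Suc)
      have "1 + a / real (Suc (n + j)) \<le> 1 + a / real n"
        using assms False by (intro add_mono divide_left_mono) auto
      also have "\<dots> \<le> exp (a / real n)"
        by (rule exp_ge_add_one_self)
      finally show "1 + a / real (Suc (n + j)) \<le> exp (a / real n)" .
    qed (use assms in auto)
    also have "\<dots> = exp (real (Suc j) * (a / real n)) * kk (a + 1) n"
      by (simp add: ring_distribs add_divide_distrib exp_add mult_ac)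
    finally show ?case .
  qed simp
  then have "kk (a + 1) (n + m) \<le> exp (real m * (a / real n)) * kk (a + 1) n" .
  also have "\<dots> \<le> exp a * kk (a + 1) n"
    using assms False by (intro mult_right_mono) (auto simp: field_simps mult_left_mono)
  finally show ?thesis .
qed (use assms in auto)

lemma kk_tendsto: "(g \<longlongrightarrow> l) F \<Longrightarrow> ((\<lambda>x. kk (g x) n) \<longlongrightarrow> kk l n) F"
  unfolding kk_def pochhammer_prod by (intro tendsto_intros) auto

section \<open>Weighted kernel operators\<close>

text \<open>The source index comes first: \<open>K p\<close> is the image of the unit vector at
  \<open>p\<close>.\<close>

definition kernel_op :: "('a \<Rightarrow> 'b \<Rightarrow> real) \<Rightarrow> ('a \<Rightarrow> complex) \<Rightarrow> 'b \<Rightarrow> complex" where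
  "kernel_op K F k = (\<Sum>\<^sub>\<infinity>p. of_real (K p k) * F p)"

context
  fixes K :: "'a \<Rightarrow> 'b \<Rightarrow> real" and F :: "'a \<Rightarrow> complex" and v :: "'b \<Rightarrow> real" and w :: "'a \<Rightarrow> real"
  assumes v: "\<And>k. 0 < v k"
    and K: "\<And>p A. finite A \<Longrightarrow> (\<Sum>k\<in>A. v k * \<bar>K p k\<bar>) \<le> w p"
    and F: "(\<lambda>p. w p * norm (F p)) summable_on UNIV"
begin

lemma kernel_row:
  "(\<lambda>k. v k * \<bar>K p k\<bar>) summable_on UNIV" "(\<Sum>\<^sub>\<infinity>k. v k * \<bar>K p k\<bar>) \<le> w p"
proof -
  show s: "(\<lambda>k. v k * \<bar>K p k\<bar>) summable_on UNIV"
    by (rule nonneg_bdd_above_summable_on) (auto simp: v less_imp_le bdd_above_def intro: K)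
  show "(\<Sum>\<^sub>\<infinity>k. v k * \<bar>K p k\<bar>) \<le> w p"
    by (rule infsum_le_finite_sums[OF s]) (rule K)
qed

text \<open>Absolute summability of the double family, which justifies every interchange of sums in
  this context.\<close>

lemma kernel_summable:
  "(\<lambda>(p, k). v k * \<bar>K p k\<bar> * norm (F p)) summable_on UNIV"
  "(\<Sum>\<^sub>\<infinity>(p, k). v k * \<bar>K p k\<bar> * norm (F p)) \<le> (\<Sum>\<^sub>\<infinity>p. w p * norm (F p))"
proof -
  have hs: "((\<lambda>k. v k * \<bar>K p k\<bar> * norm (F p)) has_sum (\<Sum>\<^sub>\<infinity>k. v k * \<bar>K p k\<bar>) * norm (F p)) UNIV" for p
    by (intro has_sum_cmult_left has_sum_infsum kernel_row)
  have g: "(\<lambda>p. (\<Sum>\<^sub>\<infinity>k. v k * \<bar>K p k\<bar>) * norm (F p)) summable_on UNIV"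
    by (rule summable_on_comparison_test[OF F])
      (auto intro!: mult_right_mono mult_nonneg_nonneg kernel_row infsum_nonneg simp: v less_imp_le)
  have "(\<lambda>(p, k). v k * \<bar>K p k\<bar> * norm (F p)) summable_on (UNIV \<times> UNIV)"
    by (rule summable_on_SigmaI[OF _ g]) (auto simp: v less_imp_le hs)
  then show s: "(\<lambda>(p, k). v k * \<bar>K p k\<bar> * norm (F p)) summable_on UNIV"
    by simp
  have "(\<Sum>\<^sub>\<infinity>(p, k). v k * \<bar>K p k\<bar> * norm (F p)) = (\<Sum>\<^sub>\<infinity>p. \<Sum>\<^sub>\<infinity>k. v k * \<bar>K p k\<bar> * norm (F p))"
    using infsum_Sigma'_banach[of "\<lambda>p k. v k * \<bar>K p k\<bar> * norm (F p)" UNIV "\<lambda>_. UNIV"] s by simp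
  also have "\<dots> = (\<Sum>\<^sub>\<infinity>p. (\<Sum>\<^sub>\<infinity>k. v k * \<bar>K p k\<bar>) * norm (F p))"
    by (intro infsum_cong infsumI hs)
  also have "\<dots> \<le> (\<Sum>\<^sub>\<infinity>p. w p * norm (F p))"
    by (intro infsum_mono g F mult_right_mono kernel_row) auto
  finally show "(\<Sum>\<^sub>\<infinity>(p, k). v k * \<bar>K p k\<bar> * norm (F p)) \<le> (\<Sum>\<^sub>\<infinity>p. w p * norm (F p))" .
qed

lemma kernel_op_abs_summable: "(\<lambda>p. norm (of_real (K p k) * F p)) summable_on UNIV"
proof -
  have "(\<lambda>p. (w p * norm (F p)) * inverse (v k)) summable_on UNIV"
    by (intro summable_on_cmult_left F)
  then show ?thesis
  proof (rule summable_on_comparison_test)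
    fix p
    have "v k * \<bar>K p k\<bar> \<le> w p"
      using K[of "{k}" p] by simp
    then have "\<bar>K p k\<bar> * norm (F p) \<le> w p * inverse (v k) * norm (F p)"
      using v[of k] by (intro mult_right_mono) (auto simp: field_simps)
    then show "norm (of_real (K p k) * F p) \<le> w p * norm (F p) * inverse (v k)"
      by (simp add: norm_mult mult_ac)
  qed auto
qed

text \<open>Boundedness from weighted l1 with weight \<open>w\<close> to weighted l1 with weight
  \<open>v\<close>: by Tonelli only the weighted l1 norms of the images of unit vectors matter, and
  these are at most \<open>w p\<close>.\<close>

lemma kernel_op_bound:
  "(\<lambda>k. v k * norm (kernel_op K F k)) summable_on UNIV"
  "(\<Sum>\<^sub>\<infinity>k. v k * norm (kernel_op K F k)) \<le> (\<Sum>\<^sub>\<infinity>p. w p * norm (F p))"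
proof -
  have sw: "(\<lambda>(k, p). v k * \<bar>K p k\<bar> * norm (F p)) summable_on (UNIV \<times> UNIV)"
    using summable_on_swap[of "\<lambda>(p, k). v k * \<bar>K p k\<bar> * norm (F p)" UNIV UNIV] kernel_summable(1)
    by (simp add: case_prod_unfold)
  have col: "(\<lambda>k. \<Sum>\<^sub>\<infinity>p. v k * \<bar>K p k\<bar> * norm (F p)) summable_on UNIV"
    using summable_on_Sigma_banach[OF sw] by simp
  have le: "v k * norm (kernel_op K F k) \<le> (\<Sum>\<^sub>\<infinity>p. v k * \<bar>K p k\<bar> * norm (F p))" for k
  proof -
    have "norm (kernel_op K F k) \<le> (\<Sum>\<^sub>\<infinity>p. norm (of_real (K p k) * F p))"
      unfolding kernel_op_def by (rule norm_infsum_bound[OF kernel_op_abs_summable])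
    then have "v k * norm (kernel_op K F k) \<le> v k * (\<Sum>\<^sub>\<infinity>p. norm (of_real (K p k) * F p))"
      using v[of k] by (intro mult_left_mono) auto
    also have "\<dots> = (\<Sum>\<^sub>\<infinity>p. v k * \<bar>K p k\<bar> * norm (F p))"
      by (subst infsum_cmult_right'[symmetric]) (simp add: norm_mult mult.assoc)
    finally show ?thesis .
  qed
  show s: "(\<lambda>k. v k * norm (kernel_op K F k)) summable_on UNIV"
    by (rule summable_on_comparison_test[OF col le]) (simp add: v less_imp_le)
  have "(\<Sum>\<^sub>\<infinity>k. v k * norm (kernel_op K F k)) \<le> (\<Sum>\<^sub>\<infinity>k. \<Sum>\<^sub>\<infinity>p. v k * \<bar>K p k\<bar> * norm (F p))"
    by (intro infsum_mono s col le)
  also have "\<dots> = (\<Sum>\<^sub>\<infinity>p. \<Sum>\<^sub>\<infinity>k. v k * \<bar>K p k\<bar> * norm (F p))"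
    by (rule infsum_swap_banach[OF sw])
  also have "\<dots> = (\<Sum>\<^sub>\<infinity>(p, k). v k * \<bar>K p k\<bar> * norm (F p))"
    using infsum_Sigma'_banach[of "\<lambda>p k. v k * \<bar>K p k\<bar> * norm (F p)" UNIV "\<lambda>_. UNIV"]
      kernel_summable(1) by simp
  also note kernel_summable(2)
  finally show "(\<Sum>\<^sub>\<infinity>k. v k * norm (kernel_op K F k)) \<le> (\<Sum>\<^sub>\<infinity>p. w p * norm (F p))" .
qed

text \<open>\<open>M\<close> is the matrix product of \<open>K\<close> and \<open>L\<close>. Since
  \<open>L\<close> is dominated by \<open>v\<close> at the fixed \<open>k\<close>, the double sum is
  dominated by the family of \<open>kernel_summable\<close>, and Fubini applies.\<close>

lemma kernel_op_comp:
  fixes L :: "'b \<Rightarrow> 'c \<Rightarrow> real" and M :: "'a \<Rightarrow> 'c \<Rightarrow> real"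
  assumes L: "\<And>l. \<bar>L l k\<bar> \<le> v l"
    and M: "\<And>p. ((\<lambda>l. K p l * L l k) has_sum M p k) UNIV"
  shows "kernel_op L (kernel_op K F) k = kernel_op M F k"
proof -
  have "(\<lambda>(p, l). norm (of_real (K p l * L l k) * F p)) summable_on UNIV"
  proof (rule summable_on_comparison_test[OF kernel_summable(1)])
    fix x :: "'a \<times> 'b"
    obtain p l where x: "x = (p, l)" by (cases x)
    have "norm (of_real (K p l * L l k) * F p) = \<bar>L l k\<bar> * (\<bar>K p l\<bar> * norm (F p))"
      by (simp add: norm_mult abs_mult)
    also have "\<dots> \<le> v l * (\<bar>K p l\<bar> * norm (F p))"
      by (intro mult_right_mono L) auto
    finally show "(case x of (p, l) \<Rightarrow> norm (of_real (K p l * L l k) * F p))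
        \<le> (case x of (p, k) \<Rightarrow> v k * \<bar>K p k\<bar> * norm (F p))"
      by (simp add: x mult.assoc)
  qed (auto split: prod.splits)
  then have s: "(\<lambda>(p, l). of_real (K p l * L l k) * F p) summable_on (UNIV \<times> UNIV)"
    using Infinite_Sum.abs_summable_summable[of "\<lambda>(p, l). of_real (K p l * L l k) * F p" UNIV]
    by (simp add: case_prod_unfold)
  have "kernel_op M F k = (\<Sum>\<^sub>\<infinity>p. \<Sum>\<^sub>\<infinity>l. of_real (K p l * L l k) * F p)"
    unfolding kernel_op_def
  proof (intro infsum_cong)
    fix p
    have "((\<lambda>l. of_real (K p l * L l k) * F p) has_sum of_real (M p k) * F p) UNIV"
      by (intro has_sum_cmult_left has_sum_of_real M)
    then show "of_real (M p k) * F p = (\<Sum>\<^sub>\<infinity>l. of_real (K p l * L l k) * F p)"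
      by (simp add: infsumI)
  qed
  also have "\<dots> = (\<Sum>\<^sub>\<infinity>l. \<Sum>\<^sub>\<infinity>p. of_real (K p l * L l k) * F p)"
    by (rule infsum_swap_banach[OF s])
  also have "\<dots> = kernel_op L (kernel_op K F) k"
    unfolding kernel_op_def by (simp add: infsum_cmult_right'[symmetric] mult_ac)
  finally show ?thesis ..
qed

end

section \<open>Atoms and synthesis\<close>

definition wt :: "real \<Rightarrow> int \<Rightarrow> real" where
  "wt a n = kk (a + 1) (nat \<bar>n\<bar>)"

text \<open>Extension by zero keeps the support conditions inside the kernel, so that sums over
  intervals can be read as sums over all integers.\<close>

definition kk_ext :: "real \<Rightarrow> int \<Rightarrow> real" where
  "kk_ext a z = (if z < 0 then 0 else kk a (nat z))"

text \<open>The case distinction is on \<open>k\<close>, not on \<open>n\<close>. As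
  \<open>kk_ext\<close> vanishes at negative arguments, a nonzero value forces
  \<open>0 \<le> k \<le> n\<close> or \<open>n \<le> k < 0\<close>, so atoms do not cross between
  the half lines, while on each half line the formula depends on a difference of indices
  only.\<close>

definition atom :: "real \<Rightarrow> int \<Rightarrow> int \<Rightarrow> real" where
  "atom a n k = (if 0 \<le> k then kk_ext a (n - k) else kk_ext a (k - n))"

abbreviation synth :: "real \<Rightarrow> seq \<Rightarrow> seq" where
  "synth a \<equiv> kernel_op (atom a)"

definition wl1 :: "real \<Rightarrow> seq set" where
  "wl1 a = {F. (\<lambda>n. wt a n * norm (F n)) summable_on UNIV}"

definition wnorm :: "real \<Rightarrow> seq \<Rightarrow> real" where
  "wnorm a F = (\<Sum>\<^sub>\<infinity>n. wt a n * norm (F n))"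

lemma wt_ge_1: "0 \<le> a \<Longrightarrow> 1 \<le> wt a n"
  by (simp add: wt_def kk_ge_1)

lemma wt_pos: "0 \<le> a \<Longrightarrow> 0 < wt a n"
  using wt_ge_1[of a n] by simp

lemma wt_nonneg [simp]: "0 \<le> a \<Longrightarrow> 0 \<le> wt a n"
  using wt_ge_1[of a n] by simp

lemma wt_0 [simp]: "wt 0 n = 1"
  by (simp add: wt_def)

lemma wt_mono: "0 \<le> a \<Longrightarrow> a \<le> b \<Longrightarrow> wt a n \<le> wt b n"
  by (simp add: wt_def kk_mono)

lemma wt_mono_index: "0 \<le> a \<Longrightarrow> \<bar>n\<bar> \<le> \<bar>k\<bar> \<Longrightarrow> wt a n \<le> wt a k"
  by (simp add: wt_def kk_mono_index)

lemma wl1_mono: "0 \<le> a \<Longrightarrow> a \<le> b \<Longrightarrow> F \<in> wl1 b \<Longrightarrow> F \<in> wl1 a"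
  unfolding wl1_def mem_Collect_eq
  by (erule summable_on_comparison_test) (auto intro: mult_right_mono wt_mono)

lemma kk_ext_nonneg [simp]: "0 \<le> a \<Longrightarrow> 0 \<le> kk_ext a z"
  by (simp add: kk_ext_def)

lemma kk_ext_neg: "z < 0 \<Longrightarrow> kk_ext a z = 0"
  by (simp add: kk_ext_def)

lemma kk_ext_le_1: "0 \<le> b \<Longrightarrow> b \<le> 1 \<Longrightarrow> kk_ext b z \<le> 1"
  by (simp add: kk_ext_def kk_le_1)

text \<open>Coefficient form of \<open>(1 - z) (1 - z)^(-(s + 1)) = (1 - z)^(-s)\<close>; extension
  by zero makes it correct at \<open>z = 0\<close> too.\<close>

lemma kk_ext_diff: "kk_ext (s + 1) z - kk_ext (s + 1) (z - 1) = kk_ext s z"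
proof (cases "z > 0")
  case True
  then have "nat z = Suc (nat (z - 1))" by simp
  with True kk_diff[of s "nat (z - 1)"] show ?thesis
    by (simp add: kk_ext_def)
qed (auto simp: kk_ext_def)

lemma kk_ext_zero: "kk_ext 0 z = (if z = 0 then 1 else 0)"
  by (simp add: kk_ext_def kk_zero)

lemma kk_ext_convolution: "(\<Sum>l\<in>{k..n}. kk_ext g (n - l) * kk_ext a (l - k)) = kk_ext (g + a) (n - k)"
proof (cases "k \<le> n")
  case True
  define N where "N = nat (n - k)"
  have n: "n = k + int N" using True by (simp add: N_def)
  have "(\<Sum>l\<in>{k..n}. kk_ext g (n - l) * kk_ext a (l - k)) = (\<Sum>i\<le>N. kk g i * kk a (N - i))"
    by (rule sum.reindex_bij_witness[where i = "\<lambda>i. n - int i" and j = "\<lambda>l. nat (n - l)"])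
      (auto simp: n kk_ext_def nat_diff_distrib intro!: arg_cong2[where f = "(*)"] arg_cong2[where f = kk])
  then show ?thesis
    by (simp add: kk_add[of g a N] n kk_ext_def)
qed (simp add: kk_ext_def)

lemma atom_nonneg [simp]: "0 \<le> a \<Longrightarrow> 0 \<le> atom a n k"
  by (simp add: atom_def)

lemma atom_le_1: "0 \<le> b \<Longrightarrow> b \<le> 1 \<Longrightarrow> atom b n k \<le> 1"
  by (simp add: atom_def kk_ext_le_1)

lemma atom_zero: "atom 0 n k = (if n = k then 1 else 0)"
  by (auto simp: atom_def kk_ext_zero)

text \<open>The semigroup law of synthesis. Only indices \<open>l\<close> between \<open>k\<close>
  and \<open>n\<close> contribute, all on one half line, and there the sum is a convolution of
  kernels.\<close>

lemma atom_comp: "((\<lambda>l. atom g n l * atom a l k) has_sum atom (g + a) n k) UNIV"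
proof (cases "0 \<le> k")
  case True
  then have "atom (g + a) n k = (\<Sum>l\<in>{k..n}. atom g n l * atom a l k)"
    by (simp add: atom_def kk_ext_convolution[symmetric])
  moreover have "atom g n l * atom a l k = 0" if "l \<notin> {k..n}" for l
    using that True by (auto simp: atom_def kk_ext_neg)
  ultimately show ?thesis
    by (intro has_sum_finite_neutralI[where B = "{k..n}"]) auto
next
  case False
  have "(\<Sum>l\<in>{n..k}. atom g n l * atom a l k) = (\<Sum>l\<in>{n..k}. kk_ext a (k - l) * kk_ext g (l - n))"
    using False by (intro sum.cong) (auto simp: atom_def)
  also have "\<dots> = atom (g + a) n k"
    using False by (subst kk_ext_convolution) (simp add: atom_def add.commute)
  finally have "atom (g + a) n k = (\<Sum>l\<in>{n..k}. atom g n l * atom a l k)" ..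
  moreover have "atom g n l * atom a l k = 0" if "l \<notin> {n..k}" for l
    using that False by (auto simp: atom_def kk_ext_neg)
  ultimately show ?thesis
    by (intro has_sum_finite_neutralI[where B = "{n..k}"]) auto
qed

text \<open>The weight is itself a kernel of order \<open>a + 1\<close>, so the weighted norm of an
  atom is a convolution of orders \<open>g\<close> and \<open>a + 1\<close>, of total order
  \<open>a + g + 1\<close>. The constant 1 here yields the constant 1 in all embeddings.\<close>

lemma atom_weight:
  assumes "0 \<le> a" "0 \<le> g" "finite A"
  shows "(\<Sum>l\<in>A. wt a l * \<bar>atom g n l\<bar>) \<le> wt (a + g) n"
proof -
  have wt_kx: "wt a l = kk_ext (a + 1) \<bar>l\<bar>" for a l
    by (simp add: wt_def kk_ext_def)
  define B where "B = (if 0 \<le> n then {0..n} else {n..-1})"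
  have "(\<Sum>l\<in>A. wt a l * \<bar>atom g n l\<bar>) = (\<Sum>l\<in>A \<inter> B. wt a l * \<bar>atom g n l\<bar>)"
    using assms(3) by (intro sum.mono_neutral_right) (auto simp: B_def atom_def kk_ext_def split: if_splits)
  also have "\<dots> \<le> (\<Sum>l\<in>B. wt a l * \<bar>atom g n l\<bar>)"
    using assms by (intro sum_mono2) (auto simp: B_def)
  also have "\<dots> \<le> wt (a + g) n"
  proof (cases "0 \<le> n")
    case True
    then have "(\<Sum>l\<in>B. wt a l * \<bar>atom g n l\<bar>) = (\<Sum>l\<in>{0..n}. kk_ext g (n - l) * kk_ext (a + 1) (l - 0))"
      using assms by (auto simp: B_def atom_def wt_kx intro!: sum.cong)
    also have "\<dots> = wt (a + g) n"
      using True by (subst kk_ext_convolution) (simp add: wt_kx add_ac)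
    finally show ?thesis by simp
  next
    case False
    then have "(\<Sum>l\<in>B. wt a l * \<bar>atom g n l\<bar>) = (\<Sum>l\<in>{n..-1}. kk_ext (a + 1) (0 - l) * kk_ext g (l - n))"
      using assms by (auto simp: B_def atom_def wt_kx intro!: sum.cong)
    \<comment> \<open>The negative half line ends at -1; adding the nonnegative term at 0 completes
      the convolution.\<close>
    also have "\<dots> \<le> (\<Sum>l\<in>{n..0}. kk_ext (a + 1) (0 - l) * kk_ext g (l - n))"
      using assms by (intro sum_mono2) auto
    also have "\<dots> = wt (a + g) n"
      using False by (subst kk_ext_convolution) (simp add: wt_kx add_ac)
    finally show ?thesis .
  qed
  finally show ?thesis .
qed

text \<open>The order of the atom exceeds that of the weight by one, so synthesis of order
  \<open>a + 1\<close> still converges pointwise on \<open>wl1 a\<close>.\<close>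

lemma atom_le_wt:
  assumes "0 \<le> a"
  shows "\<bar>atom (a + 1) n k\<bar> \<le> wt a n"
proof -
  have "kk_ext (a + 1) z \<le> wt a n" if "z \<le> \<bar>n\<bar>" for z
    using that assms kk_mono_index[of a "nat z" "nat \<bar>n\<bar>"] by (auto simp: kk_ext_def wt_def)
  then show ?thesis
    using assms by (simp add: atom_def)
qed

lemma atom_le_wt': "0 \<le> a \<Longrightarrow> \<bar>atom a n k\<bar> \<le> wt a n"
  using atom_weight[of 0 a "{k}" n] by simp

lemma synth_abs_summable:
  assumes "0 \<le> a" "\<And>n. \<bar>K n\<bar> \<le> wt a n" "F \<in> wl1 a"
  shows "(\<lambda>n. norm (of_real (K n) * F n)) summable_on UNIV"
  using assms(3) unfolding wl1_def mem_Collect_eq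
  by (rule summable_on_comparison_test) (auto simp: norm_mult intro!: mult_right_mono assms)

lemma synth_summable:
  assumes "0 \<le> a" "\<And>n. \<bar>K n\<bar> \<le> wt a n" "F \<in> wl1 a"
  shows "(\<lambda>n. of_real (K n) * F n) summable_on UNIV"
  using Infinite_Sum.abs_summable_summable[OF synth_abs_summable[OF assms]] .

lemma synth_bound:
  assumes "0 \<le> a" "0 \<le> g" "F \<in> wl1 (a + g)"
  shows "synth g F \<in> wl1 a" "wnorm a (synth g F) \<le> wnorm (a + g) F"
proof -
  note F = assms(3)[unfolded wl1_def mem_Collect_eq]
  note K = kernel_op_bound[of "wt a" "atom g" "wt (a + g)", OF wt_pos[OF assms(1)] atom_weight[OF assms(1,2)] F]
  from K(1) show "synth g F \<in> wl1 a"
    by (simp add: wl1_def)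
  from K(2) show "wnorm a (synth g F) \<le> wnorm (a + g) F"
    by (simp add: wnorm_def)
qed

text \<open>The last hypothesis is left open because it is met in two ways: by
  \<open>atom_le_1\<close> with weight 1 when \<open>d \<le> 1\<close>, and by
  \<open>atom_le_wt'\<close> when \<open>d = a\<close>.\<close>

lemma synth_comp:
  assumes "0 \<le> a" "0 \<le> g" "0 \<le> d" "F \<in> wl1 (a + g)" "\<And>l k. \<bar>atom d l k\<bar> \<le> wt a l"
  shows "synth d (synth g F) = synth (g + d) F"
proof
  fix k
  note F = assms(4)[unfolded wl1_def mem_Collect_eq]
  show "synth d (synth g F) k = synth (g + d) F k"
    by (rule kernel_op_comp[of "wt a" "atom g" "wt (a + g)", OF wt_pos[OF assms(1)] atom_weight[OF assms(1,2)] F])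
      (assumption | rule assms(5) atom_comp)+
qed

lemma synth_zero [simp]: "synth 0 F = F"
proof
  fix k
  have "((\<lambda>p. of_real (atom 0 p k) * F p) has_sum F k) UNIV"
    by (rule has_sum_finite_neutralI[where B = "{k}"]) (auto simp: atom_zero)
  then show "synth 0 F k = F k"
    by (simp add: kernel_op_def infsumI)
qed

lemma synth_diff:
  assumes "0 \<le> s" "F \<in> wl1 s" "\<And>p. atom (s + 1) p k - atom (s + 1) p k' = atom s p k"
  shows "synth (s + 1) F k - synth (s + 1) F k' = synth s F k"
proof -
  have sm: "(\<lambda>p. of_real (atom (s + 1) p k) * F p) summable_on UNIV" for k
    by (rule synth_summable[OF assms(1) _ assms(2)]) (rule atom_le_wt[OF assms(1)])
  have "synth (s + 1) F k - synth (s + 1) F k'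
      = (\<Sum>\<^sub>\<infinity>p. of_real (atom (s + 1) p k) * F p - of_real (atom (s + 1) p k') * F p)"
    unfolding kernel_op_def using infsum_add[OF sm[of k] sm[of k', THEN summable_on_uminus[THEN iffD2]]]
    by (simp add: infsum_uminus)
  also have "\<dots> = synth s F k"
    unfolding kernel_op_def by (simp add: assms(3)[symmetric] left_diff_distrib)
  finally show ?thesis .
qed

section \<open>One-sided differences lower the order of a synthesis by one\<close>

lemma Wp_S:
  assumes "0 \<le> s" "F \<in> wl1 s" "0 \<le> n"
  shows "synth (s + 1) F n - synth (s + 1) F (n + 1) = synth s F n"
proof (rule synth_diff[OF assms(1,2)])
  fix p
  show "atom (s + 1) p n - atom (s + 1) p (n + 1) = atom s p n"
    using assms(3) kk_ext_diff[of s "p - n"] by (simp add: atom_def diff_diff_eq)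
qed

lemma Wm_S:
  assumes "0 \<le> s" "F \<in> wl1 s" "n < 0"
  shows "synth (s + 1) F n - synth (s + 1) F (n - 1) = synth s F n"
proof (rule synth_diff[OF assms(1,2)])
  fix p
  show "atom (s + 1) p n - atom (s + 1) p (n - 1) = atom s p n"
    using assms(3) kk_ext_diff[of s "n - p"] by (simp add: atom_def algebra_simps)
qed

text \<open>The order may exceed the weight by as much as one. This is needed because
  \<open>m = nat \<lfloor>a\<rfloor> + 1\<close> differences are applied to a synthesis of order
  \<open>m\<close>, with \<open>F\<close> only in \<open>wl1 a\<close>.\<close>

lemma Wp_funpow_S:
  assumes "0 \<le> s" "F \<in> wl1 a" "s + real i \<le> a + 1"
    and "\<And>n. 0 \<le> n \<Longrightarrow> H n = synth (s + real i) F n" "0 \<le> n"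
  shows "(Wp ^^ i) H n = synth s F n"
  using assms(3-)
proof (induction i arbitrary: H n)
  case (Suc i)
  have F: "F \<in> wl1 (s + real i)"
    using Suc.prems(1) assms(1) by (intro wl1_mono[OF _ _ assms(2)]) auto
  have "Wp H k = synth (s + real i) F k" if "0 \<le> k" for k
    using Wp_S[OF _ F that] that assms(1) Suc.prems(2)[of k] Suc.prems(2)[of "k + 1"]
    by (simp add: Wp_def add_ac)
  then have "(Wp ^^ i) (Wp H) n = synth s F n"
    using Suc.prems by (intro Suc.IH) auto
  then show ?case
    by (simp add: funpow_Suc_right del: funpow.simps)
qed simp

lemma Wm_funpow_S:
  assumes "0 \<le> s" "F \<in> wl1 a" "s + real i \<le> a + 1"
    and "\<And>n. n < 0 \<Longrightarrow> H n = synth (s + real i) F n" "n < 0"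
  shows "(Wm ^^ i) H n = synth s F n"
  using assms(3-)
proof (induction i arbitrary: H n)
  case (Suc i)
  have F: "F \<in> wl1 (s + real i)"
    using Suc.prems(1) assms(1) by (intro wl1_mono[OF _ _ assms(2)]) auto
  have "Wm H k = synth (s + real i) F k" if "k < 0" for k
    using Wm_S[OF _ F that] that assms(1) Suc.prems(2)[of k] Suc.prems(2)[of "k - 1"]
    by (simp add: Wm_def add_ac)
  then have "(Wm ^^ i) (Wm H) n = synth s F n"
    using Suc.prems by (intro Suc.IH) auto
  then show ?case
    by (simp add: funpow_Suc_right del: funpow.simps)
qed simp

section \<open>The defining series on l1, and W as a left inverse of synthesis\<close>

lemma sums_of_int_has_sum:
  assumes "((\<lambda>p. of_real (kk_ext b (p - n)) * f p) has_sum X) UNIV"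
  shows "(\<lambda>m. of_real (kk b m) * f (n + int m)) sums X"
proof -
  have "((\<lambda>p. of_real (kk_ext b (p - n)) * f p) has_sum X) {n..}"
    using assms by (subst has_sum_cong_neutral[where T = UNIV and g = "\<lambda>p. of_real (kk_ext b (p - n)) * f p"])
      (auto simp: kk_ext_neg)
  also have "?this \<longleftrightarrow> ((\<lambda>m. of_real (kk b m) * f (n + int m)) has_sum X) UNIV"
    by (rule has_sum_reindex_bij_witness[where i = "\<lambda>m. n + int m" and j = "\<lambda>p. nat (p - n)"])
      (auto simp: kk_ext_def)
  finally show ?thesis by (rule has_sum_imp_sums)
qed

lemma sums_of_int_has_sum':
  assumes "((\<lambda>p. of_real (kk_ext b (n - p)) * f p) has_sum X) UNIV"
  shows "(\<lambda>m. of_real (kk b m) * f (n - int m)) sums X"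
proof -
  have "((\<lambda>p. of_real (kk_ext b (n - p)) * f p) has_sum X) {..n}"
    using assms by (subst has_sum_cong_neutral[where T = UNIV and g = "\<lambda>p. of_real (kk_ext b (n - p)) * f p"])
      (auto simp: kk_ext_neg)
  also have "?this \<longleftrightarrow> ((\<lambda>m. of_real (kk b m) * f (n - int m)) has_sum X) UNIV"
    by (rule has_sum_reindex_bij_witness[where i = "\<lambda>m. n - int m" and j = "\<lambda>p. nat (n - p)"])
      (auto simp: kk_ext_def)
  finally show ?thesis by (rule has_sum_imp_sums)
qed

lemma wl1_0: "F \<in> wl1 0 \<longleftrightarrow> F \<in> l1"
  by (simp add: wl1_def l1_def)

lemma wnorm_0: "wnorm 0 F = l1norm F"
  by (simp add: wnorm_def l1norm_def)

text \<open>For orders in \<open>[0, 1]\<close> the coefficients are at most 1, so summability of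
  \<open>f\<close> suffices. The sign of \<open>n\<close> selects the branch of \<open>atom\<close>
  that matches the one-sided series.\<close>

lemma Wneg_l1:
  assumes "0 \<le> b" "b \<le> 1" "f \<in> l1"
  shows "summable (\<lambda>m. of_real (kk b m) * f (n + int m))"
    "summable (\<lambda>m. of_real (kk b m) * f (n - int m))"
    "0 \<le> n \<Longrightarrow> Wp_neg b f n = synth b f n"
    "n < 0 \<Longrightarrow> Wm_neg b f n = synth b f n"
proof -
  have "(\<lambda>p. of_real (kk_ext b (h p)) * f p) summable_on UNIV" for h
    using assms by (intro synth_summable[where a = 0]) (auto simp: kk_ext_le_1 wl1_0)
  then have h: "((\<lambda>p. of_real (kk_ext b (h p)) * f p) has_sum (\<Sum>\<^sub>\<infinity>p. of_real (kk_ext b (h p)) * f p)) UNIV" for h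
    by (rule has_sum_infsum)
  note p = sums_of_int_has_sum[OF h] and m = sums_of_int_has_sum'[OF h]
  show "summable (\<lambda>m. of_real (kk b m) * f (n + int m))"
    "summable (\<lambda>m. of_real (kk b m) * f (n - int m))"
    by (rule sums_summable[OF p] sums_summable[OF m])+
  show "Wp_neg b f n = synth b f n" if "0 \<le> n"
    using sums_unique[OF p[of n]] that by (simp add: Wp_neg_def kernel_op_def atom_def)
  show "Wm_neg b f n = synth b f n" if "n < 0"
    using sums_unique[OF m[of n]] that by (simp add: Wm_neg_def kernel_op_def atom_def)
qed

lemma summable_on_int_tendsto_0:
  fixes f :: seq
  assumes "f summable_on UNIV"
  shows "(f \<longlongrightarrow> 0) at_top" "(f \<longlongrightarrow> 0) at_bot"
proof -
  have fin: "\<exists>X. finite X \<and> (\<forall>n. n \<notin> X \<longrightarrow> dist (f n) 0 < e)" if "e > 0" for e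
  proof -
    have "(sum f \<longlongrightarrow> infsum f UNIV) (finite_subsets_at_top UNIV)"
      by (rule infsum_tendsto[OF assms])
    then have "\<forall>\<^sub>F Y in finite_subsets_at_top UNIV. dist (sum f Y) (infsum f UNIV) < e / 2"
      by (rule tendstoD) (use that in auto)
    then obtain X where X: "finite X" "\<And>Y. finite Y \<Longrightarrow> X \<subseteq> Y \<Longrightarrow> dist (sum f Y) (infsum f UNIV) < e / 2"
      by (auto simp: eventually_finite_subsets_at_top)
    have "dist (f n) 0 < e" if n: "n \<notin> X" for n
    proof -
      have "dist (sum f (insert n X)) (sum f X) < e"
        using X(2)[of X] X(2)[of "insert n X"] X(1) dist_triangle_half_l[of "sum f (insert n X)" "infsum f UNIV" e "sum f X"]
        by (auto simp: dist_commute)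
      then show ?thesis
        using X(1) n by (simp add: dist_norm)
    qed
    with X(1) show ?thesis by blast
  qed
  show "(f \<longlongrightarrow> 0) at_top"
    unfolding tendsto_iff
  proof (intro allI impI)
    fix e :: real assume "e > 0"
    from fin[OF this] obtain X where X: "finite X" "\<And>n. n \<notin> X \<Longrightarrow> dist (f n) 0 < e" by blast
    obtain M where "\<And>x. x \<in> X \<Longrightarrow> x \<le> M"
      using bdd_above_finite[OF X(1)] by (auto simp: bdd_above_def)
    then have "\<forall>n\<ge>M + 1. dist (f n) 0 < e" using X(2) by fastforce
    then show "\<forall>\<^sub>F x in at_top. dist (f x) 0 < e"
      using eventually_at_top_linorder by blast
  qed
  show "(f \<longlongrightarrow> 0) at_bot"
    unfolding tendsto_iff
  proof (intro allI impI)
    fix e :: real assume "e > 0"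
    from fin[OF this] obtain X where X: "finite X" "\<And>n. n \<notin> X \<Longrightarrow> dist (f n) 0 < e" by blast
    obtain M where "\<And>x. x \<in> X \<Longrightarrow> M \<le> x"
      using bdd_below_finite[OF X(1)] by (auto simp: bdd_below_def)
    then have "\<forall>n\<le>M - 1. dist (f n) 0 < e" using X(2) by fastforce
    then show "\<forall>\<^sub>F x in at_bot. dist (f x) 0 < e"
      using eventually_at_bot_linorder by blast
  qed
qed

lemma frac_order:
  assumes "0 < a"
  defines "m \<equiv> nat \<lfloor>a\<rfloor> + 1"
  shows "0 < real m - a" "real m - a \<le> 1"
  using assms by (simp_all add: m_def) linarith+

text \<open>The fractional sum of order \<open>b = m - a\<close> raises a synthesis of order
  \<open>a\<close> to the integer order \<open>m\<close>; then \<open>m\<close> differences lower it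
  to order 0, which is the identity.\<close>

lemma synth_in_tau:
  assumes "0 < a" "F \<in> wl1 a"
  shows "synth a F \<in> tau a" "W a (synth a F) = F" "qa a (synth a F) = wnorm a F"
proof -
  define m where "m = nat \<lfloor>a\<rfloor> + 1"
  define b where "b = real m - a"
  have b: "0 \<le> b" "b \<le> 1" "a + b = real m"
    using frac_order[OF assms(1)] by (simp_all add: b_def m_def)
  have l1: "synth a F \<in> l1"
    using synth_bound(1)[of 0 a F] assms by (simp add: wl1_0)
  have comp: "synth b (synth a F) = synth (real m) F"
    using synth_comp[of 0 a b F] assms b atom_le_1[OF b(1,2)] by simp
  show W: "W a (synth a F) = F"
  proof
    fix n
    have "(Wp ^^ m) (Wp_neg b (synth a F)) n = synth 0 F n" if "0 \<le> n"
      using that assms b Wneg_l1(3)[OF b(1,2) l1]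
      by (intro Wp_funpow_S[OF _ assms(2)]) (auto simp: comp)
    moreover have "(Wm ^^ m) (Wm_neg b (synth a F)) n = synth 0 F n" if "n < 0"
      using that assms b Wneg_l1(4)[OF b(1,2) l1]
      by (intro Wm_funpow_S[OF _ assms(2)]) (auto simp: comp)
    ultimately show "W a (synth a F) n = F n"
      unfolding W_def Wp_frac_def Wm_frac_def m_def[symmetric] b_def[symmetric] by simp
  qed
  have "synth a F summable_on UNIV"
    using l1 Infinite_Sum.abs_summable_summable by (auto simp: l1_def)
  from summable_on_int_tendsto_0[OF this] show "synth a F \<in> tau a"
    using Wneg_l1(1,2)[OF b(1,2) l1] assms(2)
    unfolding tau_def m_def[symmetric] b_def[symmetric] by (simp add: W wl1_def wt_def)
  show "qa a (synth a F) = wnorm a F"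
    by (simp add: qa_def W wnorm_def wt_def)
qed

section \<open>Uniqueness on the half line\<close>

lemma abel_decseq_bound:
  fixes t :: "nat \<Rightarrow> complex" and r :: "nat \<Rightarrow> real"
  assumes t: "\<And>p. norm (\<Sum>i<p. t i) \<le> e" and r: "\<And>i. 0 \<le> r i" "\<And>i. r (Suc i) \<le> r i"
  shows "norm (\<Sum>i<p. of_real (r i) * t i) \<le> r 0 * e"
proof -
  let ?T = "\<lambda>p. \<Sum>i<p. t i"
  have "(\<Sum>i<p. of_real (r i) * t i)
      = of_real (r p) * ?T p + (\<Sum>i<p. of_real (r i - r (Suc i)) * ?T (Suc i))"
    by (induction p) (simp_all add: algebra_simps)
  also have "norm \<dots> \<le> norm (of_real (r p) * ?T p) + (\<Sum>i<p. norm (of_real (r i - r (Suc i)) * ?T (Suc i)))"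
    by (intro norm_triangle_le add_left_mono norm_sum)
  also have "\<dots> = r p * norm (?T p) + (\<Sum>i<p. (r i - r (Suc i)) * norm (?T (Suc i)))"
    by (simp add: norm_mult r abs_of_nonneg del: sum.lessThan_Suc of_real_diff)
  also have "\<dots> \<le> r p * e + (\<Sum>i<p. (r i - r (Suc i)) * e)"
    by (intro add_mono mult_left_mono sum_mono t r) (simp add: r)
  also have "\<dots> = r 0 * e"
    by (subst sum_distrib_right[symmetric]) (simp add: sum_lessThan_telescope' algebra_simps)
  finally show ?thesis .
qed

text \<open>The weights \<open>1 - r i\<close> are decreasing and contribute at most
  \<open>e\<close>; the constant weight 1 contributes another \<open>e\<close>.\<close>

lemma abel_incseq_bound:
  fixes t :: "nat \<Rightarrow> complex" and r :: "nat \<Rightarrow> real"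
  assumes t: "\<And>p. norm (\<Sum>i<p. t i) \<le> e" and r: "\<And>i. 0 \<le> r i" "\<And>i. r i \<le> 1" "\<And>i. r i \<le> r (Suc i)"
  shows "norm (\<Sum>i<p. of_real (r i) * t i) \<le> 2 * e"
proof -
  have e: "0 \<le> e" using t[of 0] by simp
  have "norm (\<Sum>i<p. of_real (1 - r i) * t i) \<le> (1 - r 0) * e"
    by (rule abel_decseq_bound[OF t]) (auto simp: r)
  also have "\<dots> \<le> 1 * e"
    using r e by (intro mult_right_mono) auto
  finally have "norm (\<Sum>i<p. of_real (1 - r i) * t i) \<le> e" by simp
  moreover have "(\<Sum>i<p. of_real (r i) * t i) = (\<Sum>i<p. t i) - (\<Sum>i<p. of_real (1 - r i) * t i)"
    by (simp add: sum_subtractf left_diff_distrib)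
  ultimately show ?thesis
    using t[of p] norm_triangle_ineq4[of "\<Sum>i<p. t i" "\<Sum>i<p. of_real (1 - r i) * t i"] by simp
qed

lemma norm_suminf_le_partial:
  fixes f :: "nat \<Rightarrow> complex"
  assumes "summable f" "\<And>p. norm (\<Sum>i<p. f i) \<le> e"
  shows "norm (suminf f) \<le> e"
  using tendsto_norm[OF summable_LIMSEQ[OF assms(1)]]
  by (rule LIMSEQ_le_const2) (use assms(2) in auto)

lemma summable_tail_bound:
  fixes t :: "nat \<Rightarrow> complex"
  assumes "summable t" "e > 0"
  obtains N where "\<And>n p. n \<ge> N \<Longrightarrow> norm (\<Sum>i<p. t (n + i)) \<le> e"
proof -
  obtain N where N: "\<And>m n. m \<ge> N \<Longrightarrow> norm (sum t {m..<n}) < e"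
    using assms summable_Cauchy[of t] by blast
  have "(\<Sum>i<p. t (n + i)) = sum t {n..<n + p}" for n p
    by (rule sum.reindex_bij_witness[where i = "\<lambda>l. l - n" and j = "\<lambda>i. n + i"]) auto
  with N show thesis by (intro that[of N]) (auto simp: less_imp_le)
qed

text \<open>Common model of \<open>Wp\<close> on the nonnegative half line and, after reflection, of
  \<open>Wm\<close> on the negative one.\<close>

definition diff_op :: "(nat \<Rightarrow> complex) \<Rightarrow> nat \<Rightarrow> complex" where
  "diff_op g n = g n - g (Suc n)"

lemma diff_op_zero_const:
  assumes "diff_op g = (\<lambda>_. 0)"
  shows "g n = g 0"
proof (induction n)
  case (Suc n)
  then show ?case using fun_cong[OF assms, of n] by (simp add: diff_op_def)
qed simp

text \<open>A sequence killed by a power of the difference is a polynomial, and a polynomial of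
  sublinear growth is constant. In the induction, \<open>diff_op h\<close> is again sublinear, hence
  constant, so \<open>h\<close> is affine.\<close>

lemma funpow_dN_zero_sublinear:
  assumes "(diff_op ^^ m) h = (\<lambda>_. 0)" "(\<lambda>n. h n / of_nat (Suc n)) \<longlonglongrightarrow> 0"
  shows "diff_op h = (\<lambda>_. 0)"
  using assms
proof (induction m arbitrary: h)
  case 0
  then show ?case by (auto simp: diff_op_def)
next
  case (Suc m)
  have "(\<lambda>n. h (Suc n) / of_nat (Suc (Suc n)) * (of_nat (Suc (Suc n)) / of_nat (Suc n))) \<longlonglongrightarrow> 0 * 1"
    by (intro tendsto_mult LIMSEQ_Suc[OF Suc.prems(2)] LIMSEQ_Suc[OF LIMSEQ_Suc_n_over_n])
  moreover have "h (Suc n) / of_nat (Suc (Suc n)) * (of_nat (Suc (Suc n)) / of_nat (Suc n)) = h (Suc n) / of_nat (Suc n)" for n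
    by (simp add: field_simps del: of_nat_Suc)
  ultimately have "(\<lambda>n. h (Suc n) / of_nat (Suc n)) \<longlonglongrightarrow> 0"
    by (simp only: mult_zero_left)
  from tendsto_diff[OF Suc.prems(2) this] have "(\<lambda>n. diff_op h n / of_nat (Suc n)) \<longlonglongrightarrow> 0"
    by (simp add: diff_op_def diff_divide_distrib)
  moreover have "(diff_op ^^ m) (diff_op h) = (\<lambda>_. 0)"
    using Suc.prems(1) by (simp add: funpow_Suc_right del: funpow.simps)
  ultimately have "diff_op (diff_op h) = (\<lambda>_. 0)" by (intro Suc.IH)
  then have const: "diff_op h n = diff_op h 0" for n
    by (rule diff_op_zero_const)
  have h: "h n = h 0 - of_nat n * diff_op h 0" for n
  proof (induction n)
    case (Suc n)
    have "h (Suc n) = h n - diff_op h n" by (simp add: diff_op_def)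
    then have "h (Suc n) = h n - diff_op h 0" by (subst (asm) const)
    also have "\<dots> = h 0 - of_nat (Suc n) * diff_op h 0" by (subst Suc) (simp add: algebra_simps)
    finally show ?case .
  qed simp
  \<comment> \<open>Dividing the affine formula by \<open>n + 1\<close> exhibits the slope as the
    limit, which sublinearity forces to be 0.\<close>
  have "(\<lambda>n. h 0 / of_nat (Suc n) - of_nat n / of_nat (Suc n) * diff_op h 0) \<longlonglongrightarrow> 0 - 1 * diff_op h 0"
    by (intro tendsto_diff tendsto_mult LIMSEQ_n_over_Suc_n tendsto_const
        LIMSEQ_Suc[OF lim_const_over_n])
  moreover have "h 0 / of_nat (Suc n) - of_nat n / of_nat (Suc n) * diff_op h 0 = h n / of_nat (Suc n)" for n
    by (subst h[of n]) (simp add: diff_divide_distrib)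
  ultimately have "(\<lambda>n. h n / of_nat (Suc n)) \<longlonglongrightarrow> - diff_op h 0" by simp
  then have "diff_op h 0 = 0"
    using LIMSEQ_unique[OF Suc.prems(2)] by fastforce
  with const show ?case by (auto simp: fun_eq_iff)
qed

text \<open>In \<open>(- b) (1 - b) (2 - b) ... / j!\<close> only the first factor is
  negative.\<close>

lemma kk_neg_nonpos:
  assumes "0 < b" "b \<le> 1" "0 < j"
  shows "kk (- b) j \<le> 0"
  using assms(3)
proof (induction j)
  case (Suc j)
  show ?case
  proof (cases "j = 0")
    case False
    then show ?thesis using Suc assms by (auto simp: kk_Suc intro!: divide_nonpos_pos mult_nonpos_nonneg)
  qed (use assms in \<open>simp add: kk_Suc\<close>)
qed simp

text \<open>Passing from \<open>i\<close> to \<open>i + 1\<close> multiplies the ratio by a fraction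
  that is at most 1 precisely because \<open>b n \<le> n\<close>.\<close>

lemma kk_ratio_mono:
  assumes "0 < b" "b \<le> 1"
  shows "kk b (Suc i) / kk b (n + Suc i) \<le> kk b i / kk b (n + i)"
proof -
  have p: "0 < kk b i" "0 < kk b (n + i)" using assms by (simp_all add: kk_pos)
  have "b * real n \<le> 1 * real n" using assms by (intro mult_right_mono) auto
  then have "(b + real i) * real (Suc (n + i)) \<le> real (Suc i) * (b + real (n + i))"
    by (simp add: algebra_simps)
  then have "(b + real i) * real (Suc (n + i)) / (real (Suc i) * (b + real (n + i))) \<le> 1"
    using assms by (simp add: divide_le_eq_1)
  then have "kk b i / kk b (n + i) * ((b + real i) * real (Suc (n + i)) / (real (Suc i) * (b + real (n + i))))
      \<le> kk b i / kk b (n + i) * 1"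
    using p by (intro mult_left_mono) auto
  moreover have "kk b (Suc i) / kk b (n + Suc i)
      = kk b i / kk b (n + i) * ((b + real i) * real (Suc (n + i)) / (real (Suc i) * (b + real (n + i))))"
    by (simp add: kk_Suc mult_ac)
  ultimately show ?thesis by simp
qed

text \<open>\<open>n k(n)\<close> does not decrease and equals \<open>b\<close> at
  \<open>n = 1\<close>. Thus the reciprocal of the kernel grows at most linearly.\<close>

lemma kk_lower:
  assumes "0 < b"
  shows "b \<le> real (Suc n) * kk b (Suc n)"
proof (induction n)
  case (Suc n)
  have "b \<le> real (Suc n) * kk b (Suc n)" by fact
  also have "\<dots> \<le> (b + real (Suc n)) * kk b (Suc n)"
    using assms by (intro mult_right_mono) auto
  also have "\<dots> = real (Suc (Suc n)) * kk b (Suc (Suc n))"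
    by (simp add: kk_Suc[of b "Suc n"])
  finally show ?case .
qed (use assms in \<open>simp add: kk_Suc\<close>)

context
  fixes b :: real and u :: "nat \<Rightarrow> complex" and h :: "nat \<Rightarrow> complex"
  assumes b: "0 < b" "b \<le> 1"
    and h: "\<And>n. (\<lambda>i. of_real (kk b i) * u (n + i)) sums h n"
begin

text \<open>The series for \<open>h n\<close> is compared with the tail of the series for
  \<open>h 0\<close>. The quotients of the coefficients decrease from \<open>1 / kk b n\<close>,
  which is at most \<open>n / b\<close>, so Abel summation bounds \<open>h n\<close> by
  \<open>n / b\<close> times a small tail.\<close>

lemma half_line_sublinear: "(\<lambda>n. h n / of_nat (Suc n)) \<longlonglongrightarrow> 0"
proof (rule LIMSEQ_I)
  fix e :: real assume e: "0 < e"
  define t where "t = (\<lambda>i. of_real (kk b i) * u i)"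
  have "summable t"
    using sums_summable[OF h[of 0]] by (simp add: t_def)
  \<comment> \<open>The factor \<open>b\<close> cancels the \<open>1 / b\<close> coming from
    \<open>kk_lower\<close>.\<close>
  moreover have "0 < e * b / 2" using e b by simp
  ultimately obtain N where N: "\<And>n p. n \<ge> N \<Longrightarrow> norm (\<Sum>i<p. t (n + i)) \<le> e * b / 2"
    using summable_tail_bound by blast
  show "\<exists>no. \<forall>n\<ge>no. norm (h n / of_nat (Suc n) - 0) < e"
  \<comment> \<open>\<open>Suc N\<close> makes \<open>n\<close> positive, as \<open>kk_lower\<close>
    at \<open>n - 1\<close> requires.\<close>
  proof (intro exI[of _ "Suc N"] allI impI)
    fix n assume n: "n \<ge> Suc N"
    define r where "r = (\<lambda>i. kk b i / kk b (n + i))"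
    have eq: "of_real (kk b i) * u (n + i) = of_real (r i) * t (n + i)" for i
      using kk_pos[OF b(1), of "n + i"] by (simp add: r_def t_def)
    have "norm (\<Sum>i<p. of_real (r i) * t (n + i)) \<le> r 0 * (e * b / 2)" for p
      by (rule abel_decseq_bound)
        (use n N b kk_ratio_mono[OF b] in \<open>auto simp: r_def\<close>)
    then have "norm (\<Sum>i. of_real (r i) * t (n + i)) \<le> r 0 * (e * b / 2)"
      using sums_summable[OF h[of n]] by (intro norm_suminf_le_partial) (simp_all only: eq)
    then have "norm (h n) \<le> r 0 * (e * b / 2)"
      using sums_unique[OF h[of n]] by (simp only: eq)
    also have "\<dots> \<le> real n * e / 2"
    proof -
      have "b \<le> real n * kk b n"
        using kk_lower[OF b(1), of "n - 1"] n by simp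
      then have "r 0 * b \<le> real n"
        using kk_pos[OF b(1), of n] by (simp add: r_def field_simps)
      then show ?thesis
        using mult_right_mono[of "r 0 * b" "real n" "e / 2"] e by (simp add: mult_ac)
    qed
    also have "\<dots> < e * real (Suc n)"
      using e by (simp add: field_simps add_nonneg_pos)
    finally show "norm (h n / of_nat (Suc n) - 0) < e"
      by (simp add: norm_divide field_simps del: of_nat_Suc)
  qed
qed

text \<open>Only conditional convergence is available, so the remainder of the truncated inversion is
  compared with the tail of \<open>\<Sum> k\<^sup>b(l) u(n + l)\<close>: the quotient of the coefficients lies in \<open>[0, 1]\<close>
  and increases with \<open>l\<close>, which is what Abel summation needs.\<close>

lemma half_line_inversion: "(\<lambda>J. \<Sum>j\<le>J. of_real (kk (- b) j) * h (n + j)) \<longlonglongrightarrow> u n"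
proof (rule LIMSEQ_I)
  fix e :: real assume e: "0 < e"
  define t where "t = (\<lambda>l. of_real (kk b l) * u (n + l))"
  have "summable t"
    using sums_summable[OF h[of n]] by (simp add: t_def)
  moreover have "0 < e / 4" using e by simp
  ultimately obtain N where N: "\<And>n p. n \<ge> N \<Longrightarrow> norm (\<Sum>i<p. t (n + i)) \<le> e / 4"
    using summable_tail_bound by blast
  show "\<exists>no. \<forall>J\<ge>no. norm ((\<Sum>j\<le>J. of_real (kk (- b) j) * h (n + j)) - u n) < e"
  proof (intro exI[of _ N] allI impI)
    fix J assume J: "J \<ge> N"
    \<comment> \<open>\<open>C l\<close> is the coefficient of \<open>u (n + l)\<close> in the
      truncated inversion. Without truncation it would be the convolution of orders
      \<open>- b\<close> and \<open>b\<close>, which is 1 at 0 and 0 elsewhere; for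
      \<open>l \<le> J\<close> the truncation has no effect.\<close>
    define C where "C = (\<lambda>l. \<Sum>j\<le>J. kk (- b) j * (if l < j then 0 else kk b (l - j)))"
    define r where "r = (\<lambda>i. C (i + Suc J) / kk b (i + Suc J))"
    have "(\<lambda>l. \<Sum>j\<le>J. of_real (kk (- b) j) * (of_real (if l < j then 0 else kk b (l - j)) * u (n + l)))
        sums (\<Sum>j\<le>J. of_real (kk (- b) j) * h (n + j))"
    proof (intro sums_sum sums_mult)
      fix j
      have "(\<lambda>l. of_real (if l + j < j then 0 else kk b (l + j - j)) * u (n + (l + j))) sums h (n + j)"
        using h[of "n + j"] by (simp add: add_ac)
      then show "(\<lambda>l. of_real (if l < j then 0 else kk b (l - j)) * u (n + l)) sums h (n + j)"
        by (subst (asm) sums_zero_iff_shift) auto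
    qed
    then have sums: "(\<lambda>l. of_real (C l) * u (n + l)) sums (\<Sum>j\<le>J. of_real (kk (- b) j) * h (n + j))"
      by (simp add: C_def sum_distrib_right mult.assoc)
    have C_low: "C l = (if l = 0 then 1 else 0)" if "l \<le> J" for l
    proof -
      have "C l = (\<Sum>j\<le>l. kk (- b) j * kk b (l - j))"
        unfolding C_def by (rule sum.mono_neutral_cong_right) (use that in auto)
      also have "\<dots> = kk (- b + b) l" by (rule kk_add[symmetric])
      finally show ?thesis by (simp add: kk_zero)
    qed
    have C_high: "C l = (\<Sum>j\<le>J. kk (- b) j * kk b (l - j))" if "l > J" for l
      unfolding C_def using that by (intro sum.cong) auto
    \<comment> \<open>The term \<open>j = 0\<close> is split off: it contributes exactly 1, and all
      remaining coefficients are nonpositive.\<close>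
    have r_eq: "r i = 1 + (\<Sum>j\<in>{1..J}. kk (- b) j * (kk b (i + Suc J - j) / kk b (i + Suc J)))" for i
    proof -
      have "{..J} = insert 0 {1..J}" by auto
      then show ?thesis
        using kk_pos[OF b(1), of "i + Suc J"]
        by (simp add: r_def C_high add_divide_distrib sum_divide_distrib)
    qed
    have r_le: "r i \<le> 1" for i
    proof -
      have "(\<Sum>j\<in>{1..J}. kk (- b) j * (kk b (i + Suc J - j) / kk b (i + Suc J))) \<le> 0"
        using b by (intro sum_nonpos mult_nonpos_nonneg kk_neg_nonpos) auto
      then show ?thesis by (simp add: r_eq)
    qed
    have r_mono: "r i \<le> r (Suc i)" for i
      unfolding r_eq
    proof (intro add_left_mono sum_mono mult_left_mono_neg)
      fix j assume j: "j \<in> {1..J}"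
      then show "kk (- b) j \<le> 0" using b by (intro kk_neg_nonpos) auto
      show "kk b (Suc i + Suc J - j) / kk b (Suc i + Suc J) \<le> kk b (i + Suc J - j) / kk b (i + Suc J)"
        using kk_ratio_mono[OF b, of "i + Suc J - j" j] j by (simp add: Suc_diff_le)
    qed
    \<comment> \<open>The complete convolution sum is 0 at \<open>l > 0\<close> and the omitted
      terms are nonpositive, so the retained part \<open>C l\<close> is nonnegative.\<close>
    have r_nonneg: "0 \<le> r i" for i
    proof -
      define l where "l = i + Suc J"
      have "0 = kk (- b + b) l" by (simp add: kk_zero l_def)
      also have "\<dots> = (\<Sum>j\<le>l. kk (- b) j * kk b (l - j))" by (rule kk_add)
      also have "{..l} = {..J} \<union> {Suc J..l}" by (auto simp: l_def)
      also have "(\<Sum>j\<in>{..J} \<union> {Suc J..l}. kk (- b) j * kk b (l - j))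
          = C l + (\<Sum>j\<in>{Suc J..l}. kk (- b) j * kk b (l - j))"
        by (subst sum.union_disjoint) (auto simp: C_high l_def)
      also have "(\<Sum>j\<in>{Suc J..l}. kk (- b) j * kk b (l - j)) \<le> 0"
        using b by (intro sum_nonpos mult_nonpos_nonneg kk_neg_nonpos) auto
      finally show ?thesis
        using b by (simp add: r_def l_def)
    qed
    have eq: "of_real (C (i + Suc J)) * u (n + (i + Suc J)) = of_real (r i) * t (Suc J + i)" for i
      using kk_pos[OF b(1), of "i + Suc J"] by (simp add: r_def t_def add_ac)
    have sm: "summable (\<lambda>i. of_real (r i) * t (Suc J + i))"
      using summable_ignore_initial_segment[OF sums_summable[OF sums], of "Suc J"]
      by (simp only: eq)
    have tail: "norm (\<Sum>i<p. t (Suc J + i)) \<le> e / 4" for p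
      using N[of "Suc J" p] J by simp
    have "norm (\<Sum>i<p. of_real (r i) * t (Suc J + i)) \<le> 2 * (e / 4)" for p
      using tail r_nonneg r_le r_mono by (rule abel_incseq_bound[where t = "\<lambda>i. t (Suc J + i)"])
    then have "norm (\<Sum>i. of_real (r i) * t (Suc J + i)) \<le> 2 * (e / 4)"
      by (rule norm_suminf_le_partial[OF sm])
    moreover have "(\<Sum>j\<le>J. of_real (kk (- b) j) * h (n + j))
        = (\<Sum>i. of_real (r i) * t (Suc J + i)) + (\<Sum>l<Suc J. of_real (C l) * u (n + l))"
      using suminf_split_initial_segment[OF sums_summable[OF sums], of "Suc J"] sums_unique[OF sums]
      by (simp only: eq)
    moreover have "(\<Sum>l<Suc J. of_real (C l) * u (n + l)) = (\<Sum>l<Suc J. if l = 0 then u n else 0)"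
      by (intro sum.cong) (auto simp: C_low)
    ultimately show "norm ((\<Sum>j\<le>J. of_real (kk (- b) j) * h (n + j)) - u n) < e"
      using e by (simp del: sum.lessThan_Suc)
  qed
qed

text \<open>Sublinear growth makes \<open>h\<close> constant, so the inversion sums no longer depend
  on the index and \<open>u\<close> is constant as well; a constant null sequence is 0. The value of
  the inversion limit is never computed.\<close>

lemma half_line_unique:
  assumes "u \<longlonglongrightarrow> 0" "(diff_op ^^ m) h = (\<lambda>_. 0)"
  shows "u n = 0"
proof -
  have "diff_op h = (\<lambda>_. 0)"
    using assms(2) half_line_sublinear by (rule funpow_dN_zero_sublinear)
  then have h0: "h n = h 0" for n
    by (rule diff_op_zero_const)
  have lim: "(\<lambda>J. \<Sum>j\<le>J. of_real (kk (- b) j) * h 0) \<longlonglongrightarrow> u k" for k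
    using half_line_inversion[of k] by (simp only: h0[of "k + _"])
  have const: "u k = u 0" for k
    by (rule LIMSEQ_unique[OF lim lim])
  then have "u = (\<lambda>_. u 0)" by auto
  with assms(1) have "(\<lambda>_::nat. u 0) \<longlonglongrightarrow> 0" by metis
  then have "u 0 = 0" by (simp add: LIMSEQ_const_iff)
  with const[of n] show ?thesis by simp
qed

end

section \<open>The spaces \<open>\<tau>\<^sup>\<alpha>\<close> as weighted \<open>l\<^sup>1\<close> spaces\<close>

lemma Wp_funpow_nat: "(Wp ^^ i) H (int n) = (diff_op ^^ i) (\<lambda>k. H (int k)) n"
proof (induction i arbitrary: n)
  case (Suc i)
  show ?case using Suc[of n] Suc[of "Suc n"] by (simp add: Wp_def diff_op_def add.commute)
qed simp

text \<open>Reflection about -1/2 carries the negative half line, which starts at -1, to the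
  naturals, so that one uniqueness result serves both sides.\<close>

lemma Wm_funpow_nat: "(Wm ^^ i) H (- 1 - int n) = (diff_op ^^ i) (\<lambda>k. H (- 1 - int k)) n"
proof (induction i arbitrary: n)
  case (Suc i)
  have "- 1 - int n - 1 = - 1 - int (Suc n)" by simp
  then show ?case using Suc[of n] Suc[of "Suc n"] by (simp only: funpow.simps o_apply Wm_def diff_op_def)
qed simp

lemma Wp_funpow_diff: "(Wp ^^ i) (\<lambda>n. f n - g n) n = (Wp ^^ i) f n - (Wp ^^ i) g n"
  by (induction i arbitrary: n) (simp_all add: Wp_def)

lemma Wm_funpow_diff: "(Wm ^^ i) (\<lambda>n. f n - g n) n = (Wm ^^ i) f n - (Wm ^^ i) g n"
  by (induction i arbitrary: n) (simp_all add: Wm_def)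

lemma qa_eq_wnorm: "qa a f = wnorm a (W a f)"
  by (simp add: qa_def wnorm_def wt_def)

lemma tau_W_in_wl1: "f \<in> tau a \<Longrightarrow> W a f \<in> wl1 a"
  by (simp add: tau_def wl1_def wt_def)

text \<open>The synthesis \<open>g\<close> of \<open>W a f\<close> lies in \<open>tau a\<close> and
  has the same derivative as \<open>f\<close>, so \<open>f - g\<close> falls under
  \<open>half_line_unique\<close> on both half lines. The difference is taken at the level of the
  series, since linearity of \<open>W\<close> on \<open>tau\<close> is itself deduced from this
  lemma.\<close>

lemma synth_W:
  assumes a: "0 < a" and f: "f \<in> tau a"
  shows "synth a (W a f) = f"
proof -
  define g where "g = synth a (W a f)"
  note F = tau_W_in_wl1[OF f]
  have g: "g \<in> tau a" and Wg: "W a g = W a f"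
    using synth_in_tau[OF a F] by (simp_all add: g_def)
  define m where "m = nat \<lfloor>a\<rfloor> + 1"
  define b where "b = real m - a"
  have b: "0 < b" "b \<le> 1"
    using frac_order[OF a] by (simp_all add: b_def m_def)
  define d where "d = (\<lambda>n. f n - g n)"
  note tau = tau_def[of a, folded m_def, folded b_def]
  note W = W_def[of a, unfolded Wp_frac_def Wm_frac_def, folded m_def, folded b_def]
  have smp: "summable (\<lambda>k. of_real (kk b k) * f (n + int k))" "summable (\<lambda>k. of_real (kk b k) * g (n + int k))" for n
    using f g by (auto simp: tau)
  have smm: "summable (\<lambda>k. of_real (kk b k) * f (n - int k))" "summable (\<lambda>k. of_real (kk b k) * g (n - int k))" for n
    using f g by (auto simp: tau)
  have sp: "(\<lambda>k. of_real (kk b k) * d (n + int k)) sums (Wp_neg b f n - Wp_neg b g n)" for n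
    using sums_diff[OF summable_sums[OF smp(1)] summable_sums[OF smp(2)]]
    by (simp add: d_def right_diff_distrib Wp_neg_def)
  have sm: "(\<lambda>k. of_real (kk b k) * d (n - int k)) sums (Wm_neg b f n - Wm_neg b g n)" for n
    using sums_diff[OF summable_sums[OF smm(1)] summable_sums[OF smm(2)]]
    by (simp add: d_def right_diff_distrib Wm_neg_def)
  have lim: "(d \<longlongrightarrow> 0) at_top" "(d \<longlongrightarrow> 0) at_bot"
    using f g tendsto_diff[of f 0 _ g 0] by (simp_all add: tau d_def)
  have W_eq: "W a f n - W a g n = 0" for n by (simp add: Wg)
  have "d (int n) = 0" for n
  proof (rule half_line_unique[OF b])
    show "(\<lambda>i. of_real (kk b i) * d (int (n + i))) sums (Wp_neg b f (int n) - Wp_neg b g (int n))" for n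
      using sp[of "int n"] by simp
    show "(\<lambda>n. d (int n)) \<longlonglongrightarrow> 0"
      by (rule filterlim_compose[OF lim(1) filterlim_int_sequentially])
    show "(diff_op ^^ m) (\<lambda>n. Wp_neg b f (int n) - Wp_neg b g (int n)) = (\<lambda>_. 0)"
    proof
      fix n
      have "(diff_op ^^ m) (\<lambda>n. Wp_neg b f (int n) - Wp_neg b g (int n)) n
          = (Wp ^^ m) (\<lambda>n. Wp_neg b f n - Wp_neg b g n) (int n)"
        by (rule Wp_funpow_nat[symmetric])
      also have "\<dots> = 0"
        using W_eq[of "int n"] unfolding Wp_funpow_diff by (simp add: W)
      finally show "(diff_op ^^ m) (\<lambda>n. Wp_neg b f (int n) - Wp_neg b g (int n)) n = 0" .
    qed
  qed
  moreover have "d (- 1 - int n) = 0" for n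
  proof (rule half_line_unique[OF b, where u = "\<lambda>n. d (- 1 - int n)"])
    show "(\<lambda>i. of_real (kk b i) * d (- 1 - int (n + i))) sums (Wm_neg b f (- 1 - int n) - Wm_neg b g (- 1 - int n))" for n
      using sm[of "- 1 - int n"] by (simp add: algebra_simps)
    have "filterlim (\<lambda>k. - 1 - int k) at_bot sequentially"
      unfolding filterlim_at_bot
    proof
      fix Z :: int
      show "\<forall>\<^sub>F k in sequentially. - 1 - int k \<le> Z"
        by (rule eventually_sequentiallyI[of "nat (- Z)"]) auto
    qed
    then show "(\<lambda>n. d (- 1 - int n)) \<longlonglongrightarrow> 0"
      by (rule filterlim_compose[OF lim(2)])
    show "(diff_op ^^ m) (\<lambda>n. Wm_neg b f (- 1 - int n) - Wm_neg b g (- 1 - int n)) = (\<lambda>_. 0)"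
    proof
      fix n
      have "(diff_op ^^ m) (\<lambda>n. Wm_neg b f (- 1 - int n) - Wm_neg b g (- 1 - int n)) n
          = (Wm ^^ m) (\<lambda>n. Wm_neg b f n - Wm_neg b g n) (- 1 - int n)"
        by (rule Wm_funpow_nat[symmetric])
      also have "\<dots> = 0"
        using W_eq[of "- 1 - int n"] unfolding Wm_funpow_diff by (simp add: W)
      finally show "(diff_op ^^ m) (\<lambda>n. Wm_neg b f (- 1 - int n) - Wm_neg b g (- 1 - int n)) n = 0" .
    qed
  qed
  moreover have "k = int (nat k) \<or> k = - 1 - int (nat (- 1 - k))" for k by auto
  ultimately have "d k = 0" for k by metis
  then show ?thesis by (auto simp: d_def g_def)
qed

section \<open>Linear structure and norm, transported by synthesis\<close>

lemma synth_add:
  assumes "0 \<le> a" "F \<in> wl1 a" "G \<in> wl1 a"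
  shows "synth a (\<lambda>n. F n + G n) = (\<lambda>n. synth a F n + synth a G n)"
proof
  fix k
  have "(\<lambda>n. of_real (atom a n k) * F n) summable_on UNIV" "(\<lambda>n. of_real (atom a n k) * G n) summable_on UNIV"
    using assms by (auto intro!: synth_summable atom_le_wt')
  then show "synth a (\<lambda>n. F n + G n) k = synth a F k + synth a G k"
    by (simp add: kernel_op_def ring_distribs infsum_add)
qed

lemma synth_fun_zero [simp]: "synth a (\<lambda>n. 0) = (\<lambda>n. 0)"
  by (simp add: fun_eq_iff kernel_op_def)

lemma synth_scale: "synth a (\<lambda>n. c * F n) = (\<lambda>n. c * synth a F n)"
  by (simp add: fun_eq_iff kernel_op_def mult.left_commute infsum_cmult_right')

lemma wl1_zero [simp]: "(\<lambda>n. 0) \<in> wl1 a"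
  by (simp add: wl1_def)

lemma wl1_add:
  assumes "0 \<le> a" "F \<in> wl1 a" "G \<in> wl1 a"
  shows "(\<lambda>n. F n + G n) \<in> wl1 a" "wnorm a (\<lambda>n. F n + G n) \<le> wnorm a F + wnorm a G"
proof -
  note FG = assms(2,3)[unfolded wl1_def mem_Collect_eq]
  have le: "wt a n * norm (F n + G n) \<le> wt a n * norm (F n) + wt a n * norm (G n)" for n
    using assms(1) by (simp add: ring_distribs[symmetric] mult_left_mono norm_triangle_ineq)
  show s: "(\<lambda>n. F n + G n) \<in> wl1 a"
    unfolding wl1_def mem_Collect_eq
    by (rule summable_on_comparison_test[OF summable_on_add[OF FG] le]) (simp add: assms)
  show "wnorm a (\<lambda>n. F n + G n) \<le> wnorm a F + wnorm a G"
    unfolding wnorm_def infsum_add[OF FG, symmetric]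
    by (intro infsum_mono s[unfolded wl1_def mem_Collect_eq] summable_on_add FG le)
qed

lemma wl1_scale: "F \<in> wl1 a \<Longrightarrow> (\<lambda>n. c * F n) \<in> wl1 a"
  by (simp add: wl1_def norm_mult mult.left_commute[of _ "norm c"] summable_on_cmult_right)

lemma wnorm_scale: "wnorm a (\<lambda>n. c * F n) = norm c * wnorm a F"
  by (simp add: wnorm_def norm_mult mult.left_commute[of _ "norm c"] infsum_cmult_right')

lemma wl1_diff: "0 \<le> a \<Longrightarrow> F \<in> wl1 a \<Longrightarrow> G \<in> wl1 a \<Longrightarrow> (\<lambda>n. F n - G n) \<in> wl1 a"
  using wl1_add(1)[of a F "\<lambda>n. - 1 * G n"] wl1_scale[of G a "- 1"] by simp

lemma wnorm_nonneg: "0 \<le> a \<Longrightarrow> 0 \<le> wnorm a F"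
  by (simp add: wnorm_def infsum_nonneg)

lemma sum_le_wnorm:
  assumes "0 \<le> a" "F \<in> wl1 a" "finite A"
  shows "(\<Sum>n\<in>A. wt a n * norm (F n)) \<le> wnorm a F"
  unfolding wnorm_def
  by (rule finite_sum_le_infsum) (use assms in \<open>auto simp: wl1_def\<close>)

lemma norm_le_wnorm:
  assumes "0 \<le> a" "F \<in> wl1 a"
  shows "norm (F n) \<le> wnorm a F"
proof -
  have "1 * norm (F n) \<le> wt a n * norm (F n)"
    using assms by (intro mult_right_mono wt_ge_1) auto
  with sum_le_wnorm[OF assms, of "{n}"] show ?thesis by simp
qed

text \<open>Synthesis is linear and maps \<open>wl1 a\<close> onto \<open>tau a\<close> with inverse
  \<open>W a\<close>; closure and linearity follow without handling the conditionally convergent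
  series again.\<close>

lemma W_lincomb:
  assumes "0 < a" "f \<in> tau a" "g \<in> tau a"
  shows "(\<lambda>n. f n + c * g n) \<in> tau a" "W a (\<lambda>n. f n + c * g n) = (\<lambda>n. W a f n + c * W a g n)"
proof -
  let ?F = "\<lambda>n. W a f n + c * W a g n"
  have F: "?F \<in> wl1 a"
    using assms by (intro wl1_add(1) wl1_scale tau_W_in_wl1) auto
  have "synth a ?F = (\<lambda>n. f n + c * g n)"
    using assms by (subst synth_add) (auto simp: wl1_scale tau_W_in_wl1 synth_scale synth_W)
  with synth_in_tau(1,2)[OF assms(1) F] show "(\<lambda>n. f n + c * g n) \<in> tau a"
    "W a (\<lambda>n. f n + c * g n) = ?F" by simp_all
qed

lemma tau_zero: "0 < a \<Longrightarrow> (\<lambda>n. 0) \<in> tau a"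
  using synth_in_tau(1)[of a "\<lambda>n. 0"] by simp

lemma tau_scale: "0 < a \<Longrightarrow> f \<in> tau a \<Longrightarrow> (\<lambda>n. c * f n) \<in> tau a"
  using synth_in_tau(1)[of a "\<lambda>n. c * W a f n"] by (simp add: wl1_scale tau_W_in_wl1 synth_scale synth_W)

lemma qa_scale: "0 < a \<Longrightarrow> f \<in> tau a \<Longrightarrow> qa a (\<lambda>n. c * f n) = norm c * qa a f"
  using synth_in_tau(3)[of a "\<lambda>n. c * W a f n"]
  by (simp add: wl1_scale tau_W_in_wl1 synth_scale synth_W wnorm_scale qa_eq_wnorm)

lemma tau_subspace: "0 < a \<Longrightarrow> is_subspace (tau a)"
  using W_lincomb(1)[of a _ _ 1] by (simp add: is_subspace_def tau_zero tau_scale)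

lemma tau_norm:
  assumes "0 < a"
  shows "is_norm_on (tau a) (qa a)"
  unfolding is_norm_on_def
proof (intro conjI ballI allI impI)
  fix f assume f: "f \<in> tau a"
  show "0 \<le> qa a f" using assms by (simp add: qa_eq_wnorm wnorm_nonneg)
  show "qa a (\<lambda>n. c * f n) = norm c * qa a f" for c
    by (rule qa_scale[OF assms f])
  show "f = (\<lambda>n. 0)" if "qa a f = 0"
  proof -
    have "W a f = (\<lambda>n. 0)"
      using norm_le_wnorm[of a "W a f"] tau_W_in_wl1[OF f] that assms
      by (auto simp: qa_eq_wnorm fun_eq_iff)
    with synth_W[OF assms f] show ?thesis by simp
  qed
  show "qa a (\<lambda>n. f n + g n) \<le> qa a f + qa a g" if "g \<in> tau a" for g
    using W_lincomb(2)[OF assms f that, of 1] wl1_add(2)[of a "W a f" "W a g"] assms f that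
    by (simp add: qa_eq_wnorm tau_W_in_wl1)
qed

section \<open>Completeness\<close>

text \<open>Weights are at least 1, so coordinates converge; the Cauchy estimate passes to the limit
  on finite sets of indices and hence to the whole sum.\<close>

lemma wl1_complete:
  assumes a: "0 \<le> a" and F: "\<And>k. F k \<in> wl1 a"
    and Cauchy: "\<And>e. e > 0 \<Longrightarrow> \<exists>N. \<forall>j\<ge>N. \<forall>k\<ge>N. wnorm a (\<lambda>n. F j n - F k n) < e"
  shows "\<exists>G\<in>wl1 a. (\<lambda>k. wnorm a (\<lambda>n. F k n - G n)) \<longlonglongrightarrow> 0"
proof -
  have D: "(\<lambda>n. F j n - F k n) \<in> wl1 a" for j k
    by (rule wl1_diff[OF a F F])
  have "\<exists>l. (\<lambda>k. F k n) \<longlonglongrightarrow> l" for n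
  proof -
    have "Cauchy (\<lambda>k. F k n)"
    proof (rule metric_CauchyI)
      fix e :: real assume "0 < e"
      then obtain N where N: "\<forall>j\<ge>N. \<forall>k\<ge>N. wnorm a (\<lambda>n. F j n - F k n) < e"
        using Cauchy by blast
      show "\<exists>M. \<forall>j\<ge>M. \<forall>k\<ge>M. dist (F j n) (F k n) < e"
      proof (intro exI[of _ N] allI impI)
        fix j k assume "N \<le> j" "N \<le> k"
        with N have "wnorm a (\<lambda>n. F j n - F k n) < e" by blast
        with norm_le_wnorm[OF a D[of j k], of n] show "dist (F j n) (F k n) < e"
          by (simp add: dist_norm)
      qed
    qed
    then show ?thesis by (simp add: Cauchy_convergent_iff convergent_def)
  qed
  then obtain G where G: "\<And>n. (\<lambda>k. F k n) \<longlonglongrightarrow> G n" by metis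
  have close: "\<exists>N. \<forall>j\<ge>N. (\<lambda>n. F j n - G n) \<in> wl1 a \<and> wnorm a (\<lambda>n. F j n - G n) \<le> e" if e: "e > 0" for e
  proof -
    obtain N where N: "\<forall>j\<ge>N. \<forall>k\<ge>N. wnorm a (\<lambda>n. F j n - F k n) < e"
      using Cauchy[OF e] by blast
    show ?thesis
    proof (intro exI[of _ N] allI impI)
      fix j assume j: "N \<le> j"
      have le: "(\<Sum>n\<in>A. wt a n * norm (F j n - G n)) \<le> e" if "finite A" for A
      proof (rule LIMSEQ_le_const2)
        show "(\<lambda>k. \<Sum>n\<in>A. wt a n * norm (F j n - F k n)) \<longlonglongrightarrow> (\<Sum>n\<in>A. wt a n * norm (F j n - G n))"
          by (intro tendsto_intros G)
        have "(\<Sum>n\<in>A. wt a n * norm (F j n - F k n)) \<le> e" if "k \<ge> N" for k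
        proof -
          have "wnorm a (\<lambda>n. F j n - F k n) < e" using N j that by blast
          with sum_le_wnorm[OF a D[of j k] \<open>finite A\<close>] show ?thesis by linarith
        qed
        then show "\<exists>N. \<forall>k\<ge>N. (\<Sum>n\<in>A. wt a n * norm (F j n - F k n)) \<le> e" by blast
      qed
      have s: "(\<lambda>n. wt a n * norm (F j n - G n)) summable_on UNIV"
        by (rule nonneg_bdd_above_summable_on) (use a le in \<open>auto simp: bdd_above_def\<close>)
      moreover have "wnorm a (\<lambda>n. F j n - G n) \<le> e"
        unfolding wnorm_def by (rule infsum_le_finite_sums[OF s le])
      ultimately show "(\<lambda>n. F j n - G n) \<in> wl1 a \<and> wnorm a (\<lambda>n. F j n - G n) \<le> e"
        by (simp add: wl1_def)
    qed
  qed
  obtain j where "(\<lambda>n. F j n - G n) \<in> wl1 a"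
    using close[of 1] by auto
  from wl1_diff[OF a F[of j] this] have "G \<in> wl1 a" by simp
  moreover have "(\<lambda>k. wnorm a (\<lambda>n. F k n - G n)) \<longlonglongrightarrow> 0"
  proof (rule LIMSEQ_I)
    fix e :: real assume "0 < e"
    then obtain N where "\<forall>j\<ge>N. wnorm a (\<lambda>n. F j n - G n) \<le> e / 2"
      using close[of "e / 2"] by auto
    then have "norm (wnorm a (\<lambda>n. F k n - G n) - 0) < e" if "k \<ge> N" for k
      using that \<open>0 < e\<close> wnorm_nonneg[OF a, of "\<lambda>n. F k n - G n"] by fastforce
    then show "\<exists>N. \<forall>k\<ge>N. norm (wnorm a (\<lambda>n. F k n - G n) - 0) < e" by blast
  qed
  ultimately show ?thesis by blast
qed

lemma W_diff:
  assumes "0 < a" "f \<in> tau a" "g \<in> tau a"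
  shows "W a (\<lambda>n. f n - g n) = (\<lambda>n. W a f n - W a g n)"
  using W_lincomb(2)[OF assms, of "- 1"] by simp

lemma tau_complete:
  assumes a: "0 < a"
  shows "complete_wrt (tau a) (qa a)"
  unfolding complete_wrt_def
proof (intro allI impI, elim conjE)
  fix X :: "nat \<Rightarrow> seq" assume X: "\<forall>k. X k \<in> tau a"
    and C: "\<forall>e>0. \<exists>N. \<forall>j\<ge>N. \<forall>k\<ge>N. qa a (\<lambda>n. X j n - X k n) < e"
  have X': "X k \<in> tau a" for k using X by simp
  have "\<exists>G\<in>wl1 a. (\<lambda>k. wnorm a (\<lambda>n. W a (X k) n - G n)) \<longlonglongrightarrow> 0"
    using a C by (intro wl1_complete tau_W_in_wl1 X') (auto simp: qa_eq_wnorm W_diff[OF a X' X'])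
  then obtain G where G: "G \<in> wl1 a" "(\<lambda>k. wnorm a (\<lambda>n. W a (X k) n - G n)) \<longlonglongrightarrow> 0"
    by blast
  have L: "synth a G \<in> tau a" "W a (synth a G) = G" using synth_in_tau[OF a G(1)] by simp_all
  have "(\<lambda>k. qa a (\<lambda>n. X k n - synth a G n)) \<longlonglongrightarrow> 0"
    using G(2) by (simp add: qa_eq_wnorm W_diff[OF a X' L(1)] L(2))
  with L(1) show "\<exists>L\<in>tau a. (\<lambda>k. qa a (\<lambda>n. X k n - L n)) \<longlonglongrightarrow> 0" by blast
qed

section \<open>Embeddings with constant one\<close>

lemma tau_l1:
  assumes "0 < a" "f \<in> tau a"
  shows "f \<in> l1" "l1norm f \<le> qa a f"
  using synth_bound[of 0 a "W a f"] assms
  by (simp_all add: synth_W tau_W_in_wl1 wl1_0 wnorm_0 qa_eq_wnorm)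

text \<open>By the semigroup law, \<open>f\<close> is the synthesis of order \<open>a\<close> of
  \<open>synth (b - a) (W b f)\<close>. That sequence is therefore \<open>W a f\<close>, and
  \<open>synth_bound\<close> controls its norm.\<close>

lemma tau_embed:
  assumes "0 < a" "a < b" "f \<in> tau b"
  shows "f \<in> tau a" "qa a f \<le> qa b f"
proof -
  let ?F = "W b f" and ?G = "synth (b - a) (W b f)"
  have F: "?F \<in> wl1 (a + (b - a))" using tau_W_in_wl1[OF assms(3)] by simp
  have G: "?G \<in> wl1 a" "wnorm a ?G \<le> wnorm b ?F"
    using synth_bound[OF _ _ F] assms by simp_all
  have "synth a ?G = synth (b - a + a) ?F"
    by (rule synth_comp[OF _ _ _ F]) (use assms atom_le_wt'[of a] in auto)
  then have eq: "synth a ?G = f" using synth_W[of b f] assms by (simp del: synth_zero)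
  from synth_in_tau(1,3)[OF assms(1) G(1)] G(2) show "f \<in> tau a" "qa a f \<le> qa b f"
    by (simp_all add: eq qa_eq_wnorm[of b])
qed

section \<open>Finitely supported sequences\<close>

lemma Wp_funpow_vanish:
  assumes "\<And>n. N < n \<Longrightarrow> H n = 0" "N < n"
  shows "(Wp ^^ i) H n = 0"
  using assms(2) by (induction i arbitrary: n) (simp_all add: Wp_def assms(1))

lemma Wm_funpow_vanish:
  assumes "\<And>n. n < N \<Longrightarrow> H n = 0" "n < N"
  shows "(Wm ^^ i) H n = 0"
  using assms(2) by (induction i arbitrary: n) (simp_all add: Wm_def assms(1))

lemma c00_bounded_support:
  assumes "f \<in> c00"
  obtains N :: int where "0 \<le> N" "\<And>n. N < \<bar>n\<bar> \<Longrightarrow> f n = 0"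
proof -
  have "finite (abs ` {n. f n \<noteq> 0})" using assms by (simp add: c00_def)
  from bdd_above_finite[OF this] obtain M where M: "\<And>x. x \<in> abs ` {n. f n \<noteq> 0} \<Longrightarrow> x \<le> M"
    unfolding bdd_above_def by blast
  show thesis
    by (rule that[of "max 0 M"]) (use M in force)+
qed

text \<open>On each half line the series and the differences only look away from the origin, so
  nothing is created outside a symmetric interval containing the support.\<close>

lemma W_vanish:
  assumes "0 \<le> N" "\<And>n. N < \<bar>n\<bar> \<Longrightarrow> f n = 0" "N < \<bar>n\<bar>"
  shows "W a f n = 0"
proof (cases "0 \<le> n")
  case True
  have "Wp_neg b f k = 0" if "N < k" for b k
    using that assms(1) by (simp add: Wp_neg_def assms(2))
  then have "Wp_frac a f n = 0"
    unfolding Wp_frac_def by (rule Wp_funpow_vanish) (use assms True in auto)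
  with True show ?thesis by (simp add: W_def)
next
  case False
  have "Wm_neg b f k = 0" if "k < - N" for b k
    using that assms(1) by (simp add: Wm_neg_def assms(2))
  then have "Wm_frac a f n = 0"
    unfolding Wm_frac_def by (rule Wm_funpow_vanish) (use assms False in auto)
  with False show ?thesis by (simp add: W_def)
qed

lemma c00_subset_tau:
  assumes a: "0 < a"
  shows "c00 \<subseteq> tau a"
proof
  fix f assume f: "f \<in> c00"
  then obtain N where N: "0 \<le> N" "\<And>n. N < \<bar>n\<bar> \<Longrightarrow> f n = 0"
    using c00_bounded_support[OF f] by blast
  have "f summable_on UNIV"
    by (rule finite_nonzero_values_imp_summable_on) (use f in \<open>simp add: c00_def\<close>)
  note lim = summable_on_int_tendsto_0[OF this]
  have l1: "f \<in> l1"
    unfolding l1_def mem_Collect_eq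
    by (rule finite_nonzero_values_imp_summable_on) (use f in \<open>simp add: c00_def\<close>)
  have "finite {n\<in>UNIV. wt a n * norm (W a f n) \<noteq> 0}"
    by (rule finite_subset[of _ "{- N..N}"]) (use W_vanish[OF N] in force)+
  then have "(\<lambda>n. wt a n * norm (W a f n)) summable_on UNIV"
    by (rule finite_nonzero_values_imp_summable_on)
  then show "f \<in> tau a"
    using lim Wneg_l1(1,2)[OF less_imp_le[OF frac_order(1)[OF a]] frac_order(2)[OF a] l1]
    unfolding tau_def wt_def by blast
qed

section \<open>Convolution of atoms\<close>

text \<open>\<open>atom_coeff \<alpha> (n, m)\<close> is \<open>W\<^sup>\<alpha>\<close> of the convolution of the atoms at \<open>n\<close> and \<open>m\<close>.  For opposite
  signs it comes from the fact that one-sided differences commute with translations.\<close>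

definition atom_coeff :: "real \<Rightarrow> int \<times> int \<Rightarrow> int \<Rightarrow> real" where
  "atom_coeff a = (\<lambda>(n, m) l.
     if 0 \<le> n \<and> 0 \<le> m then (if 0 \<le> l then kk_ext a (n + m - l) * (1 - of_bool (l < m) - of_bool (l < n)) else 0)
     else if n < 0 \<and> m < 0 then (if l < 0 then kk_ext a (l - n - m) * (1 - of_bool (m \<le> l) - of_bool (n \<le> l)) else 0)
     else if 0 \<le> l then (if l < max n m then kk_ext a (l - n - m) else 0)
     else (if min n m \<le> l then kk_ext a (n + m - l) else 0))"

definition atom_conv :: "real \<Rightarrow> int \<times> int \<Rightarrow> int \<Rightarrow> real" where
  "atom_conv a = (\<lambda>(n, m) k. \<Sum>\<^sub>\<infinity>j. atom a n (k - j) * atom a m j)"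

lemma atom_coeff_commute: "atom_coeff a (n, m) l = atom_coeff a (m, n) l"
  by (auto simp: atom_coeff_def add.commute max.commute min.commute algebra_simps)

lemma atom_conv_commute: "atom_conv a (n, m) k = atom_conv a (m, n) k"
  unfolding atom_conv_def prod.case
  by (rule infsum_reindex_bij_witness[where i = "\<lambda>j. k - j" and j = "\<lambda>j. k - j"]) auto

lemma atom_coeff_support: "atom_coeff a (n, m) l \<noteq> 0 \<Longrightarrow> \<bar>l\<bar> \<le> \<bar>n\<bar> + \<bar>m\<bar>"
  by (auto simp: atom_coeff_def kk_ext_def split: if_splits)

lemma atom_coeff_ker_summable: "(\<lambda>l. atom_coeff a (n, m) l * atom a l k) summable_on UNIV"
proof (rule finite_nonzero_values_imp_summable_on)
  show "finite {l \<in> UNIV. atom_coeff a (n, m) l * atom a l k \<noteq> 0}"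
  proof (rule finite_subset)
    show "{l \<in> UNIV. atom_coeff a (n, m) l * atom a l k \<noteq> 0} \<subseteq> {- (\<bar>n\<bar> + \<bar>m\<bar>)..\<bar>n\<bar> + \<bar>m\<bar>}"
      using atom_coeff_support[of a n m] by force
  qed simp
qed

lemma infsum_reflect:
  fixes P :: "int \<Rightarrow> real"
  assumes "\<And>l. P (c - l) = P l"
  shows "(\<Sum>\<^sub>\<infinity>l. P l * f (c - l)) = (\<Sum>\<^sub>\<infinity>l. P l * f l)"
  by (rule infsum_reindex_bij_witness[where i = "\<lambda>l. c - l" and j = "\<lambda>l. c - l"]) (auto simp: assms)

text \<open>\<open>P\<close> is symmetric under \<open>l \<mapsto> c - l\<close>, so a cutoff at one
  end of a summation window may be replaced by its reflection at the other end. Applied to products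
  of two kernels, this makes the window independent of the evaluation point
  \<open>k\<close>.\<close>

lemma infsum_indicator_split:
  fixes P :: "int \<Rightarrow> real"
  assumes fin: "finite {l. P l \<noteq> 0}" and refl: "\<And>l. P (c - l) = P l"
    and dec: "\<And>l. A l = 1 - B l - D (c - l)"
  shows "(\<Sum>\<^sub>\<infinity>l. P l * A l) = (\<Sum>\<^sub>\<infinity>l. P l * (1 - B l - D l))"
proof -
  have sm: "(\<lambda>l. P l * g l) summable_on UNIV" for g
    by (rule finite_nonzero_values_imp_summable_on) (rule finite_subset[OF _ fin], auto)
  have "(\<Sum>\<^sub>\<infinity>l. P l * A l) = (\<Sum>\<^sub>\<infinity>l. P l * (1 - B l) + - (P l * D (c - l)))"
    by (simp add: dec algebra_simps)
  also have "\<dots> = (\<Sum>\<^sub>\<infinity>l. P l * (1 - B l)) - (\<Sum>\<^sub>\<infinity>l. P l * D (c - l))"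
    using sm by (subst infsum_add) (simp_all add: infsum_uminus summable_on_uminus)
  also have "\<dots> = (\<Sum>\<^sub>\<infinity>l. P l * (1 - B l)) - (\<Sum>\<^sub>\<infinity>l. P l * D l)"
    by (simp add: infsum_reflect[where P = P, OF refl])
  also have "\<dots> = (\<Sum>\<^sub>\<infinity>l. P l * (1 - B l) + - (P l * D l))"
    using sm by (subst infsum_add) (simp_all add: infsum_uminus summable_on_uminus)
  also have "\<dots> = (\<Sum>\<^sub>\<infinity>l. P l * (1 - B l - D l))"
    by (simp add: algebra_simps)
  finally show ?thesis .
qed

text \<open>With \<open>l = m + k - j\<close> the product of the atoms becomes \<open>P l\<close> on
  the window \<open>m \<le> l \<le> m + k\<close>. Its complement consists of \<open>l < m\<close>
  and \<open>l > m + k\<close>, and reflection in \<open>n + m + k\<close> turns the latter into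
  \<open>l < n\<close>.\<close>

lemma atom_conv_nonneg_nonneg:
  assumes "0 \<le> n" "0 \<le> m"
  shows "atom_conv a (n, m) k = (\<Sum>\<^sub>\<infinity>l. atom_coeff a (n, m) l * atom a l k)"
proof (cases "0 \<le> k")
  case True
  define P where "P = (\<lambda>l. kk_ext a (n + m - l) * kk_ext a (l - k))"
  have "atom_conv a (n, m) k = (\<Sum>\<^sub>\<infinity>l. P l * of_bool (m \<le> l \<and> l \<le> m + k))"
    unfolding atom_conv_def prod.case
    by (rule infsum_reindex_bij_witness[where i = "\<lambda>l. m + k - l" and j = "\<lambda>j. m + k - j"])
      (use assms True in \<open>auto simp: P_def atom_def kk_ext_def algebra_simps split: if_splits\<close>)
  also have "\<dots> = (\<Sum>\<^sub>\<infinity>l. P l * (1 - of_bool (l < m) - of_bool (l < n)))"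
  proof (rule infsum_indicator_split[where c = "n + m + k"])
    show "finite {l. P l \<noteq> 0}"
      by (rule finite_subset[of _ "{k..n + m}"]) (auto simp: P_def kk_ext_def split: if_splits)
  qed (use True in \<open>auto simp: P_def algebra_simps\<close>)
  also have "\<dots> = (\<Sum>\<^sub>\<infinity>l. atom_coeff a (n, m) l * atom a l k)"
    using assms True by (intro infsum_cong) (auto simp: atom_coeff_def atom_def P_def kk_ext_neg)
  finally show ?thesis .
next
  case False
  have "atom a n (k - j) * atom a m j = 0" for j
    using assms False by (auto simp: atom_def kk_ext_def)
  moreover have "atom_coeff a (n, m) l * atom a l k = 0" for l
    using assms False by (auto simp: atom_coeff_def atom_def kk_ext_def)
  ultimately show ?thesis
    unfolding atom_conv_def prod.case by (simp only: infsum_0_simp)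
qed

text \<open>The mirror image of the previous case. The window is open, \<open>m + k < l < m\<close>,
  because 0 does not belong to the negative half line, and so the cutoffs become
  \<open>m \<le> l\<close> and \<open>n \<le> l\<close>.\<close>

lemma atom_conv_neg_neg:
  assumes "n < 0" "m < 0"
  shows "atom_conv a (n, m) k = (\<Sum>\<^sub>\<infinity>l. atom_coeff a (n, m) l * atom a l k)"
proof (cases "k < 0")
  case True
  define P where "P = (\<lambda>l. kk_ext a (l - n - m) * kk_ext a (k - l))"
  have "atom_conv a (n, m) k = (\<Sum>\<^sub>\<infinity>l. P l * of_bool (m + k < l \<and> l < m))"
    unfolding atom_conv_def prod.case
    by (rule infsum_reindex_bij_witness[where i = "\<lambda>l. m + k - l" and j = "\<lambda>j. m + k - j"])
      (use assms True in \<open>auto simp: P_def atom_def kk_ext_def algebra_simps split: if_splits\<close>)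
  also have "\<dots> = (\<Sum>\<^sub>\<infinity>l. P l * (1 - of_bool (m \<le> l) - of_bool (n \<le> l)))"
  proof (rule infsum_indicator_split[where c = "n + m + k"])
    show "finite {l. P l \<noteq> 0}"
      by (rule finite_subset[of _ "{n + m..k}"]) (auto simp: P_def kk_ext_def split: if_splits)
  qed (use True in \<open>auto simp: P_def algebra_simps\<close>)
  also have "\<dots> = (\<Sum>\<^sub>\<infinity>l. atom_coeff a (n, m) l * atom a l k)"
    using assms True by (intro infsum_cong) (auto simp: atom_coeff_def atom_def P_def kk_ext_neg)
  finally show ?thesis .
next
  case False
  have "atom a n (k - j) * atom a m j = 0" for j
    using assms False by (auto simp: atom_def kk_ext_def)
  moreover have "atom_coeff a (n, m) l * atom a l k = 0" for l
    using assms False by (auto simp: atom_coeff_def atom_def kk_ext_def)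
  ultimately show ?thesis
    unfolding atom_conv_def prod.case by (simp only: infsum_0_simp)
qed

text \<open>For \<open>j < 0\<close> the translate of the atom at \<open>n\<close> by
  \<open>j\<close> agrees on \<open>k \<ge> 0\<close> with the atom at \<open>n + j\<close>, so the
  values of the atom at \<open>m\<close> become the coefficients. For \<open>k < 0\<close> the two
  atoms exchange roles.\<close>

lemma atom_conv_nonneg_neg:
  assumes "0 \<le> n" "m < 0"
  shows "atom_conv a (n, m) k = (\<Sum>\<^sub>\<infinity>l. atom_coeff a (n, m) l * atom a l k)"
proof (cases "0 \<le> k")
  case True
  show ?thesis
    unfolding atom_conv_def prod.case
    by (rule infsum_reindex_bij_witness[where i = "\<lambda>l. l - n" and j = "\<lambda>j. n + j"])
      (use assms True in \<open>auto simp: atom_coeff_def atom_def kk_ext_def max_def min_def algebra_simps\<close>)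
next
  case False
  show ?thesis
    unfolding atom_conv_def prod.case
    by (rule infsum_reindex_bij_witness[where i = "\<lambda>l. m + k - l" and j = "\<lambda>j. m + k - j"])
      (use assms False in \<open>auto simp: atom_coeff_def atom_def kk_ext_def max_def min_def algebra_simps\<close>)
qed

lemma atom_coeff_comp: "((\<lambda>l. atom_coeff a p l * atom a l k) has_sum atom_conv a p k) UNIV"
proof -
  obtain n m where p: "p = (n, m)" by (cases p)
  have "atom_conv a (n, m) k = (\<Sum>\<^sub>\<infinity>l. atom_coeff a (n, m) l * atom a l k)"
    using atom_conv_nonneg_nonneg[of n m] atom_conv_neg_neg[of n m] atom_conv_nonneg_neg[of n m a k] atom_conv_nonneg_neg[of m n a k]
    by (cases "0 \<le> n"; cases "0 \<le> m") (simp_all add: atom_conv_commute[of a n m] atom_coeff_commute[of a n m])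
  then show ?thesis
    using has_sum_infsum[OF atom_coeff_ker_summable[of a n m k]] by (simp add: p)
qed

section \<open>Weighted bounds for the derivative of a product of atoms\<close>

text \<open>The range \<open>L \<ge> N\<close> contributes 1 and the range \<open>L \<le> M\<close>
  contributes \<open>1 + a\<close> times \<open>kk (a + 1) (N + M) * kk (a + 1) M\<close>; doubling
  then replaces \<open>N + M\<close> by \<open>N\<close>.\<close>

lemma kk_product_bound:
  assumes a: "0 < a" and MN: "M \<le> N"
  shows "(\<Sum>L\<le>N + M. kk (a + 1) L * (kk a (N + M - L) * (of_bool (L \<le> M) + of_bool (N \<le> L))))
    \<le> (2 + a) * exp a * kk (a + 1) N * kk (a + 1) M" (is "?lhs \<le> _")
proof -
  let ?k = "kk (a + 1)"
  have nn: "0 \<le> ?k i" "0 \<le> kk a i" for i using a by simp_all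
  have "?lhs = (\<Sum>L\<le>N + M. ?k L * kk a (N + M - L) * of_bool (L \<le> M))
      + (\<Sum>L\<le>N + M. ?k L * kk a (N + M - L) * of_bool (N \<le> L))"
    unfolding sum.distrib[symmetric] by (rule sum.cong) (simp_all add: ring_distribs)
  also have "(\<Sum>L\<le>N + M. ?k L * kk a (N + M - L) * of_bool (L \<le> M)) = (\<Sum>L\<le>M. ?k L * kk a (N + M - L))"
    by (rule sum.mono_neutral_cong_right) auto
  also have "(\<Sum>L\<le>N + M. ?k L * kk a (N + M - L) * of_bool (N \<le> L)) = (\<Sum>L\<in>{N..N + M}. ?k L * kk a (N + M - L))"
    by (rule sum.mono_neutral_cong_right) auto
  also have "(\<Sum>L\<in>{N..N + M}. ?k L * kk a (N + M - L)) \<le> (\<Sum>L\<in>{N..N + M}. ?k (N + M) * kk a (N + M - L))"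
    using a by (intro sum_mono mult_right_mono kk_mono_index) auto
  also have "\<dots> = ?k (N + M) * (\<Sum>x\<le>M. kk a x)"
    unfolding sum_distrib_left
    by (rule sum.reindex_bij_witness[where i = "\<lambda>x. N + M - x" and j = "\<lambda>L. N + M - L"]) auto
  also have "\<dots> = ?k (N + M) * ?k M" by (simp add: kk_sum)
  \<comment> \<open>\<open>kk a\<close> decreases for \<open>a < 1\<close> and increases for
    \<open>a > 1\<close>, so it is first rewritten by \<open>kk_shift\<close>. The gain
    \<open>a / (a + M)\<close> compensates for the \<open>M + 1\<close> terms.\<close>
  also have "(\<Sum>L\<le>M. ?k L * kk a (N + M - L)) \<le> (\<Sum>L\<le>M. ?k M * (?k (N + M) * (a / (a + real M))))"
  proof (intro sum_mono mult_mono)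
    fix L assume L: "L \<in> {..M}"
    define y where "y = N + M - L"
    have y: "M \<le> y" "y \<le> N + M" using L MN by (auto simp: y_def)
    have "kk a y = ?k y * (a / (a + real y))"
      using kk_shift[of a y] a by (simp add: field_simps)
    also have "\<dots> \<le> ?k (N + M) * (a / (a + real M))"
      using a y by (intro mult_mono kk_mono_index divide_left_mono) auto
    finally show "kk a (N + M - L) \<le> ?k (N + M) * (a / (a + real M))" by (simp add: y_def)
    show "?k L \<le> ?k M" using a L by (intro kk_mono_index) auto
  qed (simp_all add: nn)
  also have "\<dots> = ?k (N + M) * ?k M * (real (Suc M) * (a / (a + real M)))"
    by simp
  also have "\<dots> \<le> ?k (N + M) * ?k M * (1 + a)"
  proof (intro mult_left_mono)
    show "real (Suc M) * (a / (a + real M)) \<le> 1 + a"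
      using a by (simp add: field_simps)
  qed (simp add: nn)
  also have "?k (N + M) * ?k M * (1 + a) + ?k (N + M) * ?k M = (2 + a) * (?k (N + M) * ?k M)"
    by (simp add: algebra_simps)
  also have "\<dots> \<le> (2 + a) * (exp a * ?k N * ?k M)"
    using a MN by (intro mult_left_mono mult_right_mono kk_doubling) (auto simp: nn)
  finally show ?thesis by (simp add: mult_ac)
qed

lemma atom_coeff_same_sign_bound:
  assumes a: "0 < a" and nm: "\<bar>m\<bar> \<le> \<bar>n\<bar>" "0 \<le> n \<longleftrightarrow> 0 \<le> m" and A: "finite A"
  shows "(\<Sum>l\<in>A. wt a l * \<bar>atom_coeff a (n, m) l\<bar>) \<le> (2 + a) * exp a * wt a n * wt a m"
proof -
  define N M where "N = nat \<bar>n\<bar>" and "M = nat \<bar>m\<bar>"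
  \<comment> \<open>Both cutoffs are closed in order to cover both signs: for nonnegative indices
    the inner one is \<open>l < m\<close>, for negative indices it is
    \<open>\<bar>l\<bar> \<le> \<bar>m\<bar>\<close>, and the outer one is closed only in the
    nonnegative case.\<close>
  define g where "g = (\<lambda>L. kk (a + 1) L * (kk a (N + M - L) * (of_bool (L \<le> M) + of_bool (N \<le> L))))"
  define B where "B = {l \<in> A. (0 \<le> l \<longleftrightarrow> 0 \<le> n) \<and> \<bar>l\<bar> \<le> \<bar>n\<bar> + \<bar>m\<bar>}"
  have g_nonneg: "0 \<le> g L" for L using a by (simp add: g_def)
  have fin: "finite B" using A by (simp add: B_def)
  have inj: "inj_on (\<lambda>l. nat \<bar>l\<bar>) B" by (auto simp: B_def inj_on_def)
  have "(\<Sum>l\<in>A. wt a l * \<bar>atom_coeff a (n, m) l\<bar>) = (\<Sum>l\<in>B. wt a l * \<bar>atom_coeff a (n, m) l\<bar>)"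
  proof (rule sum.mono_neutral_right[OF A])
    show "\<forall>l\<in>A - B. wt a l * \<bar>atom_coeff a (n, m) l\<bar> = 0"
    proof
      fix l assume l: "l \<in> A - B"
      have "atom_coeff a (n, m) l = 0"
      proof (cases "0 \<le> l \<longleftrightarrow> 0 \<le> n")
        case True
        with l have "\<not> \<bar>l\<bar> \<le> \<bar>n\<bar> + \<bar>m\<bar>" by (simp add: B_def)
        then show ?thesis using atom_coeff_support by blast
      next
        case False
        then show ?thesis using nm(2) by (cases "0 \<le> n") (simp_all add: atom_coeff_def)
      qed
      then show "wt a l * \<bar>atom_coeff a (n, m) l\<bar> = 0" by simp
    qed
  qed (auto simp: B_def)
  also have "\<dots> \<le> (\<Sum>l\<in>B. g (nat \<bar>l\<bar>))"
  proof (rule sum_mono)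
    fix l assume l: "l \<in> B"
    have kk: "kk a (N + M - nat \<bar>l\<bar>) = kk_ext a (\<bar>n\<bar> + \<bar>m\<bar> - \<bar>l\<bar>)"
      using l by (auto simp: B_def kk_ext_def N_def M_def nat_diff_distrib nat_add_distrib)
    have "\<bar>atom_coeff a (n, m) l\<bar> \<le> kk_ext a (\<bar>n\<bar> + \<bar>m\<bar> - \<bar>l\<bar>) * (of_bool (\<bar>l\<bar> \<le> \<bar>m\<bar>) + of_bool (\<bar>n\<bar> \<le> \<bar>l\<bar>))"
    proof (cases "0 \<le> n")
      case True
      then have s: "0 \<le> m" "0 \<le> l" "m \<le> n" using nm l by (auto simp: B_def)
      then have "\<bar>1 - of_bool (l < m) - of_bool (l < n)\<bar> \<le> (of_bool (\<bar>l\<bar> \<le> \<bar>m\<bar>) + of_bool (\<bar>n\<bar> \<le> \<bar>l\<bar>) :: real)"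
        using True by (cases "l < m"; cases "l < n") simp_all
      with True s a show ?thesis by (simp add: atom_coeff_def abs_mult mult_left_mono)
    next
      case False
      then have s: "m < 0" "l < 0" "n \<le> m" using nm l by (auto simp: B_def)
      then have bd: "\<bar>1 - of_bool (m \<le> l) - of_bool (n \<le> l)\<bar> \<le> (of_bool (\<bar>l\<bar> \<le> \<bar>m\<bar>) + of_bool (\<bar>n\<bar> \<le> \<bar>l\<bar>) :: real)"
        using False by (cases "m \<le> l"; cases "n \<le> l") simp_all
      have eq: "\<bar>n\<bar> + \<bar>m\<bar> - \<bar>l\<bar> = l - n - m" using False s by simp
      show ?thesis
        unfolding eq using bd False s a by (simp add: atom_coeff_def abs_mult mult_left_mono)
    qed
    also have "\<dots> = kk a (N + M - nat \<bar>l\<bar>) * (of_bool (nat \<bar>l\<bar> \<le> M) + of_bool (N \<le> nat \<bar>l\<bar>))"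
      unfolding kk by (simp add: N_def M_def nat_le_eq_zle)
    finally show "wt a l * \<bar>atom_coeff a (n, m) l\<bar> \<le> g (nat \<bar>l\<bar>)"
      using a unfolding g_def wt_def by (intro mult_left_mono) auto
  qed
  also have "\<dots> = (\<Sum>L\<in>(\<lambda>l. nat \<bar>l\<bar>) ` B. g L)"
    by (simp add: sum.reindex[OF inj])
  also have "\<dots> \<le> (\<Sum>L\<le>N + M. g L)"
    using fin g_nonneg by (intro sum_mono2) (auto simp: B_def N_def M_def)
  also have "\<dots> \<le> (2 + a) * exp a * kk (a + 1) N * kk (a + 1) M"
    unfolding g_def using nm by (intro kk_product_bound[OF a]) (simp add: N_def M_def)
  finally show ?thesis by (simp add: wt_def N_def M_def)
qed

lemma kk_ext_sum_le:
  assumes "0 \<le> a" "finite A" "inj_on \<phi> A" "\<And>l. l \<in> A \<Longrightarrow> \<phi> l \<le> int N"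
  shows "(\<Sum>l\<in>A. kk_ext a (\<phi> l)) \<le> kk (a + 1) N"
proof -
  have "(\<Sum>l\<in>A. kk_ext a (\<phi> l)) = (\<Sum>z\<in>\<phi> ` A. kk_ext a z)"
    by (simp add: sum.reindex[OF assms(3)])
  also have "\<dots> = (\<Sum>z\<in>\<phi> ` A \<inter> {0..}. kk_ext a z)"
    using assms(2) by (intro sum.mono_neutral_right) (auto simp: kk_ext_def)
  also have "\<dots> \<le> (\<Sum>z\<in>{0..int N}. kk_ext a z)"
    using assms by (intro sum_mono2) auto
  also have "\<dots> = (\<Sum>i\<le>N. kk a i)"
    by (rule sum.reindex_bij_witness[where i = int and j = nat]) (auto simp: kk_ext_def)
  finally show ?thesis by (simp add: kk_sum)
qed

text \<open>On each half line the weight is at most that of the atom on the same side, while the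
  coefficients are values of the other atom and sum to at most its weight.\<close>

lemma atom_coeff_mixed_bound:
  assumes a: "0 < a" and nm: "0 \<le> n" "m < 0" and A: "finite A"
  shows "(\<Sum>l\<in>A. wt a l * \<bar>atom_coeff a (n, m) l\<bar>) \<le> 2 * (wt a n * wt a m)"
proof -
  let ?B = "{l \<in> A. 0 \<le> l \<and> l < n}" and ?D = "{l \<in> A. l < 0 \<and> m \<le> l}"
  have "(\<Sum>l\<in>A. wt a l * \<bar>atom_coeff a (n, m) l\<bar>) = (\<Sum>l\<in>?B \<union> ?D. wt a l * \<bar>atom_coeff a (n, m) l\<bar>)"
    using A nm by (intro sum.mono_neutral_right) (auto simp: atom_coeff_def)
  also have "\<dots> = (\<Sum>l\<in>?B. wt a l * \<bar>atom_coeff a (n, m) l\<bar>) + (\<Sum>l\<in>?D. wt a l * \<bar>atom_coeff a (n, m) l\<bar>)"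
    using A by (intro sum.union_disjoint) auto
  also have "(\<Sum>l\<in>?B. wt a l * \<bar>atom_coeff a (n, m) l\<bar>) \<le> (\<Sum>l\<in>?B. wt a n * kk_ext a (l - n - m))"
    using a nm by (intro sum_mono mult_mono wt_mono_index) (auto simp: atom_coeff_def)
  also have "\<dots> = wt a n * (\<Sum>l\<in>?B. kk_ext a (l - n - m))"
    by (simp add: sum_distrib_left)
  also have "\<dots> \<le> wt a n * wt a m"
    using a A nm unfolding wt_def[of a m]
    by (intro mult_left_mono kk_ext_sum_le) (auto simp: inj_on_def)
  also have "(\<Sum>l\<in>?D. wt a l * \<bar>atom_coeff a (n, m) l\<bar>) \<le> (\<Sum>l\<in>?D. wt a m * kk_ext a (n + m - l))"
    using a nm by (intro sum_mono mult_mono wt_mono_index) (auto simp: atom_coeff_def)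
  also have "\<dots> = wt a m * (\<Sum>l\<in>?D. kk_ext a (n + m - l))"
    by (simp add: sum_distrib_left)
  also have "\<dots> \<le> wt a m * wt a n"
    using a A nm unfolding wt_def[of a n]
    by (intro mult_left_mono kk_ext_sum_le) (auto simp: inj_on_def)
  finally show ?thesis by (simp add: mult.commute)
qed

lemma atom_coeff_bound:
  assumes a: "0 < a" and A: "finite A"
  shows "(\<Sum>l\<in>A. wt a l * \<bar>atom_coeff a p l\<bar>) \<le> (case p of (n, m) \<Rightarrow> (2 + a) * exp a * wt a n * wt a m)"
proof -
  \<comment> \<open>The constant 2 of mixed signs is absorbed by the constant of equal
    signs.\<close>
  have "1 * 2 \<le> exp a * (2 + a)" using a by (intro mult_mono) auto
  then have 2: "2 * (wt a n * wt a m) \<le> (2 + a) * exp a * wt a n * wt a m" for n m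
    using a mult_right_mono[of 2 "(2 + a) * exp a" "wt a n * wt a m"] by (simp add: mult_ac)
  obtain n m where p: "p = (n, m)" by (cases p)
  have "(\<Sum>l\<in>A. wt a l * \<bar>atom_coeff a (n, m) l\<bar>) \<le> (2 + a) * exp a * wt a n * wt a m"
  proof (cases "0 \<le> n \<longleftrightarrow> 0 \<le> m")
    case True
    have "(\<Sum>l\<in>A. wt a l * \<bar>atom_coeff a (m, n) l\<bar>) \<le> (2 + a) * exp a * wt a m * wt a n" if "\<bar>n\<bar> \<le> \<bar>m\<bar>"
      by (rule atom_coeff_same_sign_bound[OF a that _ A]) (use True in simp)
    moreover have "(\<Sum>l\<in>A. wt a l * \<bar>atom_coeff a (n, m) l\<bar>) \<le> (2 + a) * exp a * wt a n * wt a m" if "\<bar>m\<bar> \<le> \<bar>n\<bar>"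
      by (rule atom_coeff_same_sign_bound[OF a that True A])
    ultimately show ?thesis
      unfolding atom_coeff_commute[of a m n] by (metis linear mult.assoc mult.commute)
  next
    case False
    have "(\<Sum>l\<in>A. wt a l * \<bar>atom_coeff a (n, m) l\<bar>) \<le> 2 * (wt a n * wt a m)"
    proof (cases "0 \<le> n")
      case True
      then show ?thesis using False by (intro atom_coeff_mixed_bound[OF a _ _ A]) auto
    next
      case neg: False
      then have "(\<Sum>l\<in>A. wt a l * \<bar>atom_coeff a (m, n) l\<bar>) \<le> 2 * (wt a m * wt a n)"
        using False by (intro atom_coeff_mixed_bound[OF a _ _ A]) auto
      then show ?thesis unfolding atom_coeff_commute[of a m n] by (simp only: mult.commute)
    qed
    then show ?thesis using 2[of n m] by linarith
  qed
  then show ?thesis by (simp add: p)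
qed

section \<open>The Banach algebra property\<close>

lemma wl1_tensor:
  assumes a: "0 \<le> a" and F: "F \<in> wl1 a" and G: "G \<in> wl1 a"
  shows "((\<lambda>(n, m). wt a n * wt a m * norm (F n * G m)) has_sum wnorm a F * wnorm a G) UNIV"
proof -
  note F' = F[unfolded wl1_def mem_Collect_eq] and G' = G[unfolded wl1_def mem_Collect_eq]
  have inner: "((\<lambda>m. (wt a n * norm (F n)) * (wt a m * norm (G m))) has_sum (wt a n * norm (F n)) * wnorm a G) UNIV" for n
    unfolding wnorm_def by (intro has_sum_cmult_right has_sum_infsum G')
  have outer: "((\<lambda>n. (wt a n * norm (F n)) * wnorm a G) has_sum wnorm a F * wnorm a G) UNIV"
    unfolding wnorm_def[of a F] by (intro has_sum_cmult_left has_sum_infsum F')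
  have "(\<lambda>(n, m). (wt a n * norm (F n)) * (wt a m * norm (G m))) summable_on (UNIV \<times> UNIV)"
    by (rule summable_on_SigmaI[OF _ has_sum_imp_summable[OF outer]]) (use a inner in auto)
  then have "((\<lambda>(n, m). (wt a n * norm (F n)) * (wt a m * norm (G m))) has_sum wnorm a F * wnorm a G) (UNIV \<times> UNIV)"
    by (intro has_sum_SigmaI[OF _ outer]) (use inner in auto)
  then show ?thesis
    by (simp add: norm_mult mult_ac)
qed

text \<open>The convolution of two syntheses is the operator with kernel \<open>atom_conv\<close>
  applied to the tensor product of \<open>F\<close> and \<open>G\<close>. That kernel factors
  through \<open>atom_coeff\<close>, whose weighted bound gives the norm estimate.\<close>

lemma conv_S:
  assumes a: "0 < a" and F: "F \<in> wl1 a" and G: "G \<in> wl1 a"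
  defines "FG \<equiv> (\<lambda>(n, m). F n * G m)"
  shows "conv (synth a F) (synth a G) = synth a (kernel_op (atom_coeff a) FG)"
    and "kernel_op (atom_coeff a) FG \<in> wl1 a"
    and "wnorm a (kernel_op (atom_coeff a) FG) \<le> (2 + a) * exp a * wnorm a F * wnorm a G"
proof -
  have a': "0 \<le> a" using a by simp
  have prod: "((\<lambda>p. (case p of (n, m) \<Rightarrow> wt a n * wt a m) * norm (FG p)) has_sum wnorm a F * wnorm a G) UNIV"
    using wl1_tensor[OF a' F G] by (simp add: FG_def case_prod_unfold)
  let ?w = "\<lambda>p. case p of (n, m) \<Rightarrow> (2 + a) * exp a * wt a n * wt a m"
  have prodC: "((\<lambda>p. ?w p * norm (FG p)) has_sum (2 + a) * exp a * (wnorm a F * wnorm a G)) UNIV"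
    using has_sum_cmult_right[OF prod, of "(2 + a) * exp a"] by (simp add: case_prod_unfold mult.assoc)
  note hyps = wt_pos[OF a'] atom_coeff_bound[OF a] has_sum_imp_summable[OF prodC]
  show "kernel_op (atom_coeff a) FG \<in> wl1 a"
    unfolding wl1_def mem_Collect_eq by (rule kernel_op_bound(1)[where v = "wt a" and w = ?w]) (fact hyps)+
  have "wnorm a (kernel_op (atom_coeff a) FG) \<le> (\<Sum>\<^sub>\<infinity>p. ?w p * norm (FG p))"
    unfolding wnorm_def by (rule kernel_op_bound(2)[where v = "wt a" and w = ?w]) (fact hyps)+
  also have "\<dots> = (2 + a) * exp a * (wnorm a F * wnorm a G)"
    by (rule infsumI[OF prodC])
  finally show "wnorm a (kernel_op (atom_coeff a) FG) \<le> (2 + a) * exp a * wnorm a F * wnorm a G"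
    by (simp add: mult.assoc)
  show "conv (synth a F) (synth a G) = synth a (kernel_op (atom_coeff a) FG)"
  proof
    fix k
    have "synth a (kernel_op (atom_coeff a) FG) k = kernel_op (atom_conv a) FG k"
    proof (rule kernel_op_comp[where v = "wt a" and w = ?w])
      show "\<bar>atom a l k\<bar> \<le> wt a l" for l by (rule atom_le_wt'[OF a'])
      show "((\<lambda>l. atom_coeff a p l * atom a l k) has_sum atom_conv a p k) UNIV" for p by (rule atom_coeff_comp)
    qed (fact hyps)+
    also have "\<dots> = conv (synth a F) (synth a G) k"
    proof -
      define K where "K = (\<lambda>(n, m) j. atom a n (k - j) * atom a m j)"
      have K: "(\<Sum>j\<in>A. (1::real) * \<bar>K p j\<bar>) \<le> (case p of (n, m) \<Rightarrow> wt a n * wt a m)" if "finite A" for A p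
      proof -
        obtain n m where p: "p = (n, m)" by (cases p)
        have "(\<Sum>j\<in>A. 1 * \<bar>K p j\<bar>) \<le> (\<Sum>j\<in>A. wt a n * \<bar>atom a m j\<bar>)"
          unfolding K_def p prod.case using atom_le_wt'[OF a']
          by (intro sum_mono) (simp add: abs_mult mult_right_mono)
        also have "\<dots> = wt a n * (\<Sum>j\<in>A. wt 0 j * \<bar>atom a m j\<bar>)"
          by (simp add: sum_distrib_left)
        also have "\<dots> \<le> wt a n * wt a m"
          using atom_weight[OF _ a' that, of 0 m] a' by (intro mult_left_mono) auto
        finally show ?thesis by (simp add: p)
      qed
      note hypsK = zero_less_one K has_sum_imp_summable[OF prod]
      have row: "((\<lambda>j. K p j * 1) has_sum atom_conv a p k) UNIV" for p
      proof -
        have "(\<lambda>j. 1 * \<bar>K p j\<bar>) summable_on UNIV"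
          by (rule kernel_row(1)[where v = "\<lambda>_. 1"]) (fact hypsK)+
        then have "K p summable_on UNIV"
          using Infinite_Sum.abs_summable_summable[of "K p" UNIV] by simp
        then show ?thesis
          using has_sum_infsum[of "K p" UNIV] by (cases p) (simp add: atom_conv_def K_def)
      qed
      have KF: "kernel_op K FG j = synth a F (k - j) * synth a G j" for j
      proof -
        have "(\<lambda>p. norm (of_real (K p j) * FG p)) summable_on UNIV"
          by (rule kernel_op_abs_summable[where v = "\<lambda>_. 1"]) (fact hypsK)+
        then have "(\<lambda>p. of_real (K p j) * FG p) summable_on (UNIV \<times> UNIV)"
          using Infinite_Sum.abs_summable_summable by fastforce
        from infsum_Sigma_banach[OF this]
        have "kernel_op K FG j = (\<Sum>\<^sub>\<infinity>n. \<Sum>\<^sub>\<infinity>m. (of_real (atom a n (k - j)) * F n) * (of_real (atom a m j) * G m))"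
          by (simp add: kernel_op_def K_def FG_def mult_ac)
        also have "\<dots> = synth a F (k - j) * synth a G j"
          by (simp add: infsum_cmult_right' infsum_cmult_left' kernel_op_def)
        finally show ?thesis .
      qed
      \<comment> \<open>Summation over \<open>j\<close> is viewed as a kernel operator with constant
        kernel into a one-point index set, so that \<open>kernel_op_comp\<close> also performs this
        interchange of sums.\<close>
      have "kernel_op (\<lambda>j (_::unit). 1) (kernel_op K FG) () = kernel_op (\<lambda>p _. atom_conv a p k) FG ()"
      proof (rule kernel_op_comp[where v = "\<lambda>_. 1" and M = "\<lambda>p _. atom_conv a p k"])
        show "((\<lambda>l. K p l * 1) has_sum atom_conv a p k) UNIV" for p by (rule row)
      qed (fact hypsK | simp)+
      then show ?thesis
        by (simp add: kernel_op_def[of "\<lambda>j _. 1"] kernel_op_def[of "\<lambda>p _. atom_conv a p k"] kernel_op_def[of "atom_conv a"] KF conv_def)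
    qed
    finally show "conv (synth a F) (synth a G) k = synth a (kernel_op (atom_coeff a) FG) k" ..
  qed
qed

lemma tau_conv:
  assumes "0 < a" "f \<in> tau a" "g \<in> tau a"
  shows "conv f g \<in> tau a" "qa a (conv f g) \<le> (2 + a) * exp a * qa a f * qa a g"
proof -
  let ?H = "kernel_op (atom_coeff a) (\<lambda>(n, m). W a f n * W a g m)"
  note c = conv_S[OF assms(1) tau_W_in_wl1[OF assms(2)] tau_W_in_wl1[OF assms(3)]]
  have eq: "conv f g = synth a ?H" using c(1) synth_W assms by simp
  show "conv f g \<in> tau a" unfolding eq by (rule synth_in_tau(1)[OF assms(1) c(2)])
  show "qa a (conv f g) \<le> (2 + a) * exp a * qa a f * qa a g"
    unfolding eq qa_eq_wnorm synth_in_tau(2)[OF assms(1) c(2)] by (rule c(3))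
qed

lemma l1_bounded:
  assumes "f \<in> l1"
  shows "norm (f n) \<le> l1norm f"
  using norm_le_wnorm[of 0 f n] assms by (simp add: wl1_0 wnorm_0)

text \<open>Fubini, with the majorant obtained from the boundedness of \<open>f\<close> and a
  sheared tensor product of \<open>g\<close> and \<open>h\<close>.\<close>

lemma conv_assoc:
  assumes f: "f \<in> l1" and g: "g \<in> l1" and h: "h \<in> l1"
  shows "conv (conv f g) h = conv f (conv g h)"
proof
  fix n
  have "((\<lambda>(i, j). norm (g i * h j)) has_sum wnorm 0 g * wnorm 0 h) UNIV"
    using wl1_tensor[of 0 g h] g h by (simp add: wl1_0)
  then have "(\<lambda>(i, j). norm (g i * h j)) summable_on UNIV"
    by (rule has_sum_imp_summable)
  also have "?this \<longleftrightarrow> (\<lambda>(i, j). norm (g (i - j) * h j)) summable_on UNIV"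
    by (rule summable_on_reindex_bij_witness[where i = "\<lambda>(i, j). (i - j, j)" and j = "\<lambda>(i, j). (i + j, j)"]) auto
  finally have "(\<lambda>p. l1norm f * (case p of (i, j) \<Rightarrow> norm (g (i - j) * h j))) summable_on UNIV"
    by (rule summable_on_cmult_right)
  then have "(\<lambda>(i, j). norm (f (n - i) * (g (i - j) * h j))) summable_on UNIV"
  proof (rule summable_on_comparison_test)
    fix p :: "int \<times> int"
    show "(case p of (i, j) \<Rightarrow> norm (f (n - i) * (g (i - j) * h j)))
        \<le> l1norm f * (case p of (i, j) \<Rightarrow> norm (g (i - j) * h j))"
      using l1_bounded[OF f] by (cases p) (simp add: norm_mult[of "f _"] mult_right_mono)
  qed (auto split: prod.splits)
  then have s: "(\<lambda>(i, j). f (n - i) * (g (i - j) * h j)) summable_on (UNIV \<times> UNIV)"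
    using Infinite_Sum.abs_summable_summable[of "\<lambda>(i, j). f (n - i) * (g (i - j) * h j)" UNIV]
    by (simp add: case_prod_unfold)
  have "conv (conv f g) h n = (\<Sum>\<^sub>\<infinity>j. \<Sum>\<^sub>\<infinity>i. f (n - j - i) * g i * h j)"
    by (simp add: conv_def infsum_cmult_left')
  also have "\<dots> = (\<Sum>\<^sub>\<infinity>j. \<Sum>\<^sub>\<infinity>i. f (n - i) * (g (i - j) * h j))"
  proof (rule infsum_cong)
    fix j
    show "(\<Sum>\<^sub>\<infinity>i. f (n - j - i) * g i * h j) = (\<Sum>\<^sub>\<infinity>i. f (n - i) * (g (i - j) * h j))"
      by (rule infsum_reindex_bij_witness[where i = "\<lambda>i. i - j" and j = "\<lambda>i. i + j"])
        (auto simp: algebra_simps)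
  qed
  also have "\<dots> = (\<Sum>\<^sub>\<infinity>i. \<Sum>\<^sub>\<infinity>j. f (n - i) * (g (i - j) * h j))"
    by (rule infsum_swap_banach[OF s, symmetric])
  also have "\<dots> = conv f (conv g h) n"
    by (simp add: conv_def infsum_cmult_right')
  finally show "conv (conv f g) h n = conv f (conv g h) n" .
qed

section \<open>The limit of the norms as \<alpha> tends to 0\<close>

lemma finite_suminf:
  fixes f :: "nat \<Rightarrow> complex"
  assumes "\<And>m. M \<le> m \<Longrightarrow> f m = 0"
  shows "suminf f = (\<Sum>m<M. f m)"
  by (rule suminf_finite) (use assms in auto)

text \<open>The support bound truncates the series at a place independent of the order, so
  continuity of finitely many kernel values in the order suffices.\<close>

lemma Wneg_tendsto:
  assumes N: "0 \<le> N" "\<And>n. N < \<bar>n\<bar> \<Longrightarrow> f n = 0"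
  shows "((\<lambda>a. Wp_neg (1 - a) f n) \<longlongrightarrow> Wp_neg 1 f n) (at_right 0)"
    "((\<lambda>a. Wm_neg (1 - a) f n) \<longlongrightarrow> Wm_neg 1 f n) (at_right 0)"
proof -
  let ?M = "nat (N + \<bar>n\<bar> + 1)"
  have p: "Wp_neg b f n = (\<Sum>m<?M. of_real (kk b m) * f (n + int m))" for b
    unfolding Wp_neg_def by (rule finite_suminf) (use N in auto)
  have m: "Wm_neg b f n = (\<Sum>m<?M. of_real (kk b m) * f (n - int m))" for b
    unfolding Wm_neg_def by (rule finite_suminf) (use N in auto)
  have "((\<lambda>a. 1 - a) \<longlongrightarrow> 1 - 0) (at_right (0::real))" by (intro tendsto_intros)
  then have kk: "((\<lambda>a. kk (1 - a) j) \<longlongrightarrow> kk 1 j) (at_right 0)" for j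
    by (intro kk_tendsto) simp
  show "((\<lambda>a. Wp_neg (1 - a) f n) \<longlongrightarrow> Wp_neg 1 f n) (at_right 0)"
    unfolding p by (intro tendsto_intros kk)
  show "((\<lambda>a. Wm_neg (1 - a) f n) \<longlongrightarrow> Wm_neg 1 f n) (at_right 0)"
    unfolding m by (intro tendsto_intros kk)
qed

text \<open>The kernel of order 1 is constantly 1, so these are plain one-sided sums and the
  difference removes their first term.\<close>

lemma Wneg_1_diff:
  assumes "f \<in> l1"
  shows "Wp_neg 1 f n - Wp_neg 1 f (n + 1) = f n" "Wm_neg 1 f n - Wm_neg 1 f (n - 1) = f n"
proof -
  have p: "summable (\<lambda>m. f (n + int m))" and m: "summable (\<lambda>m. f (n - int m))"
    using Wneg_l1(1,2)[of 1 f n] assms by simp_all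
  show "Wp_neg 1 f n - Wp_neg 1 f (n + 1) = f n"
    using suminf_split_head[OF p] by (simp add: Wp_neg_def add_ac)
  show "Wm_neg 1 f n - Wm_neg 1 f (n - 1) = f n"
    using suminf_split_head[OF m] by (simp add: Wm_neg_def diff_diff_eq)
qed

text \<open>For \<open>0 < a < 1\<close> one difference is used, so \<open>W a f\<close> tends
  pointwise to \<open>f\<close>. All \<open>W a f\<close> vanish outside one fixed interval, hence
  the limit is taken in a finite sum.\<close>

lemma qa_tendsto_l1norm:
  assumes f: "f \<in> c00"
  shows "((\<lambda>a. qa a f) \<longlongrightarrow> l1norm f) (at_right 0)"
proof -
  obtain N where N: "0 \<le> N" "\<And>n. N < \<bar>n\<bar> \<Longrightarrow> f n = 0"
    using c00_bounded_support[OF f] by blast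
  have l1: "f \<in> l1"
    using tau_l1(1)[of 1 f] c00_subset_tau[of 1] f by auto
  have ev: "\<forall>\<^sub>F a in at_right (0::real). 0 < a \<and> a < 1"
    by (rule eventually_at_rightI[of 0 1]) auto
  have W_eq: "W a f n = (if 0 \<le> n then Wp_neg (1 - a) f n - Wp_neg (1 - a) f (n + 1)
      else Wm_neg (1 - a) f n - Wm_neg (1 - a) f (n - 1))" if "0 < a \<and> a < 1" for a n
  proof -
    have "\<lfloor>a\<rfloor> = 0" using that by (simp add: floor_eq_iff)
    then show ?thesis by (simp add: W_def Wp_frac_def Wm_frac_def Wp_def Wm_def)
  qed
  have W_lim: "((\<lambda>a. W a f n) \<longlongrightarrow> f n) (at_right 0)" for n
  proof (rule Lim_transform_eventually)
    show "\<forall>\<^sub>F a in at_right 0. (if 0 \<le> n then Wp_neg (1 - a) f n - Wp_neg (1 - a) f (n + 1)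
        else Wm_neg (1 - a) f n - Wm_neg (1 - a) f (n - 1)) = W a f n"
      using ev by eventually_elim (simp add: W_eq)
    show "((\<lambda>a. if 0 \<le> n then Wp_neg (1 - a) f n - Wp_neg (1 - a) f (n + 1)
        else Wm_neg (1 - a) f n - Wm_neg (1 - a) f (n - 1)) \<longlongrightarrow> f n) (at_right 0)"
    proof (cases "0 \<le> n")
      case True
      have "((\<lambda>a. Wp_neg (1 - a) f n - Wp_neg (1 - a) f (n + 1)) \<longlongrightarrow> Wp_neg 1 f n - Wp_neg 1 f (n + 1)) (at_right 0)"
        by (intro tendsto_diff Wneg_tendsto[OF N])
      then show ?thesis using True by (simp add: Wneg_1_diff[OF l1])
    next
      case False
      have "((\<lambda>a. Wm_neg (1 - a) f n - Wm_neg (1 - a) f (n - 1)) \<longlongrightarrow> Wm_neg 1 f n - Wm_neg 1 f (n - 1)) (at_right 0)"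
        by (intro tendsto_diff Wneg_tendsto[OF N])
      then show ?thesis using False by (simp add: Wneg_1_diff[OF l1])
    qed
  qed
  have q: "qa a f = (\<Sum>n\<in>{- N..N}. kk (a + 1) (nat \<bar>n\<bar>) * norm (W a f n))" for a
    unfolding qa_def
    by (rule infsumI, rule has_sum_finite_neutralI[where B = "{- N..N}"]) (use W_vanish[OF N] in force)+
  have l: "l1norm f = (\<Sum>n\<in>{- N..N}. kk 1 (nat \<bar>n\<bar>) * norm (f n))"
    unfolding l1norm_def
    by (rule infsumI, rule has_sum_finite_neutralI[where B = "{- N..N}"]) (use N in force)+
  have "((\<lambda>a. a + 1) \<longlongrightarrow> 0 + 1) (at_right (0::real))" by (intro tendsto_intros)
  then have "((\<lambda>a. kk (a + 1) j) \<longlongrightarrow> kk 1 j) (at_right 0)" for j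
    by (intro kk_tendsto) simp
  then show ?thesis
    unfolding q l by (intro tendsto_intros W_lim)
qed

theorem theorem2p11:
  shows
  "(\<forall>\<alpha>>0. is_norm_on c00 (qa \<alpha>)
      \<and> (\<exists>C>0. (\<forall>f\<in>c00. \<forall>g\<in>c00. qa \<alpha> (conv f g) \<le> C * qa \<alpha> f * qa \<alpha> g)
             \<and> (\<forall>f\<in>tau \<alpha>. \<forall>g\<in>tau \<alpha>. conv f g \<in> tau \<alpha>
                    \<and> qa \<alpha> (conv f g) \<le> C * qa \<alpha> f * qa \<alpha> g))
      \<and> is_subspace (tau \<alpha>) \<and> is_norm_on (tau \<alpha>) (qa \<alpha>) \<and> complete_wrt (tau \<alpha>) (qa \<alpha>)
      \<and> (\<forall>f\<in>tau \<alpha>. \<forall>g\<in>tau \<alpha>. \<forall>h\<in>tau \<alpha>. conv (conv f g) h = conv f (conv g h))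
      \<and> tau \<alpha> \<subseteq> l1
      \<and> (\<forall>f\<in>tau \<alpha>. l1norm f \<le> qa \<alpha> f))
   \<and> (\<forall>\<alpha> \<beta>. 0 < \<alpha> \<and> \<alpha> < \<beta> \<longrightarrow>
        (\<forall>f\<in>c00. l1norm f \<le> qa \<alpha> f \<and> qa \<alpha> f \<le> qa \<beta> f)
        \<and> tau \<beta> \<subseteq> tau \<alpha>
        \<and> (\<forall>f\<in>tau \<beta>. l1norm f \<le> qa \<alpha> f \<and> qa \<alpha> f \<le> qa \<beta> f))
   \<and> (\<forall>f\<in>c00. ((\<lambda>a. qa a f) \<longlongrightarrow> l1norm f) (at_right 0))"
proof (intro conjI allI impI)
  fix a :: real assume a: "0 < a"
  note sub = c00_subset_tau[OF a]
  show "is_norm_on (tau a) (qa a)" by (rule tau_norm[OF a])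
  then show "is_norm_on c00 (qa a)"
    using sub unfolding is_norm_on_def by (meson subsetD)
  have C: "0 < (2 + a) * exp a" using a by simp
  show "\<exists>C>0. (\<forall>f\<in>c00. \<forall>g\<in>c00. qa a (conv f g) \<le> C * qa a f * qa a g)
      \<and> (\<forall>f\<in>tau a. \<forall>g\<in>tau a. conv f g \<in> tau a \<and> qa a (conv f g) \<le> C * qa a f * qa a g)"
    using C tau_conv[OF a] sub by (intro exI[of _ "(2 + a) * exp a"]) blast
  show "is_subspace (tau a)" by (rule tau_subspace[OF a])
  show "complete_wrt (tau a) (qa a)" by (rule tau_complete[OF a])
  show "\<forall>f\<in>tau a. \<forall>g\<in>tau a. \<forall>h\<in>tau a. conv (conv f g) h = conv f (conv g h)"
    using conv_assoc tau_l1(1)[OF a] by blast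
  show "tau a \<subseteq> l1" using tau_l1(1)[OF a] by blast
  show "\<forall>f\<in>tau a. l1norm f \<le> qa a f" using tau_l1(2)[OF a] by blast
next
  fix a b :: real assume "0 < a \<and> a < b"
  then have a: "0 < a" and ab: "a < b" and b: "0 < b" by auto
  show sub: "tau b \<subseteq> tau a" using tau_embed(1)[OF a ab] by blast
  show le: "\<forall>f\<in>tau b. l1norm f \<le> qa a f \<and> qa a f \<le> qa b f"
    using tau_embed[OF a ab] tau_l1(2)[OF a] by blast
  show "\<forall>f\<in>c00. l1norm f \<le> qa a f \<and> qa a f \<le> qa b f"
    using le c00_subset_tau[OF b] by blast
next
  show "\<forall>f\<in>c00. ((\<lambda>a. qa a f) \<longlongrightarrow> l1norm f) (at_right 0)"
    using qa_tendsto_l1norm by blast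
qed

end
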